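(* In the CSA model and asymptotic regime described in the context ($M\to\infty$, $\alpha=N/M$ constant), the probability $p_\ell$ satisfies $$p_{\ell}=1-\exp\Bigg\{-\frac{\pi\alpha}{k}\sum_{h=1}^{\theta}\Lambda_h\sum_{t=0}^{n_h-1}p_{\ell-1}^{t}(1-p_{\ell-1})^{n_h-1-t}\Big[(n_h-t)\tilde e^{(h)}_{n_h-t}-(t+1)\tilde e^{(h)}_{n_h-1-t}\Big]\Bigg\}$$ for $\ell\ge1$, with starting point $p_0=1-\exp\{-\pi\alpha/R\}$.
   Context: CSA model: $M$ slots per frame, each with $k$ slices; $N=\alpha M$ users, each active independently with probability $\pi$; each active user independently picks code $\mathscr C_h$ with probability $\Lambda_h$, where $\mathscr C_h$ ($h=1,\dots,\theta$) is an $(n_h,k)$ binary linear block code with minimum distance $d_h\ge2$ and no idle symbols, and sends its $n_h$ encoded segments in $n_h$ uniformly random slices. $\bar n=\sum_h\Lambda_hn_h$, rate $R=k/\bar n$. Collision channel with collision detection and ideal interference subtraction; decoding alternates local MAP erasure decoding at each user (burst node) and subtraction of recovered segments in slices (slice nodes) of the bipartite user–slice graph. $p_\ell$: probability that an edge of this graph is connected to a slice node where a collision still persists at iteration $\ell$. Un-normalized information function: for an $(n,k)$ code with generator matrix $\mathbf G$, $\tilde e_g$ is the sum over all $g$-subsets of columns of $\mathbf G$ of the rank of the corresponding $k\times g$ submatrix ($\tilde e_0=0$); $\tilde e^{(h)}_g$ is this for $\mathscr C_h$. *)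

theory Defs
  imports "HOL-Probability.Probability"
begin

section \<open>Binary linear codes (generator matrix G :: row \<Rightarrow> column \<Rightarrow> bool, k rows, n columns)\<close>

text \<open>Codeword obtained by encoding the message whose 1-positions form the set U of rows
  (GF(2) sum of the rows in U).\<close>
definition cw :: "(nat \<Rightarrow> nat \<Rightarrow> bool) \<Rightarrow> nat set \<Rightarrow> nat \<Rightarrow> bool" where
  "cw G U j = odd (card {i \<in> U. G i j})"

definition col_indep :: "(nat \<Rightarrow> nat \<Rightarrow> bool) \<Rightarrow> nat \<Rightarrow> nat set \<Rightarrow> bool" where
  "col_indep G k I = (\<forall>F \<subseteq> I. F \<noteq> {} \<longrightarrow> (\<exists>i<k. odd (card {j \<in> F. G i j})))"

definition col_rank :: "(nat \<Rightarrow> nat \<Rightarrow> bool) \<Rightarrow> nat \<Rightarrow> nat set \<Rightarrow> nat" where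
  "col_rank G k J = Max (card ` {I. I \<subseteq> J \<and> col_indep G k I})"

definition info_fun :: "(nat \<Rightarrow> nat \<Rightarrow> bool) \<Rightarrow> nat \<Rightarrow> nat \<Rightarrow> nat \<Rightarrow> nat" where
  "info_fun G k n g = (\<Sum>J \<in> {J. J \<subseteq> {..<n} \<and> card J = g}. col_rank G k J)"

definition good_code :: "(nat \<Rightarrow> nat \<Rightarrow> bool) \<Rightarrow> nat \<Rightarrow> nat \<Rightarrow> bool" where
  "good_code G k n =
     (col_rank G k {..<n} = k \<and>
      (\<forall>U \<subseteq> {..<k}. U \<noteq> {} \<longrightarrow> card {j \<in> {..<n}. cw G U j} \<ge> 2) \<and>
      (\<forall>j<n. \<exists>i<k. G i j))"

definition map_recovers :: "(nat \<Rightarrow> nat \<Rightarrow> bool) \<Rightarrow> nat \<Rightarrow> nat set \<Rightarrow> nat \<Rightarrow> bool" where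
  "map_recovers G k K j =
     (\<forall>U V. U \<subseteq> {..<k} \<longrightarrow> V \<subseteq> {..<k} \<longrightarrow>
        (\<forall>j'\<in>K. cw G U j' = cw G V j') \<longrightarrow> cw G U j = cw G V j)"

text \<open>A user configuration: None (inactive) or Some (h, xs), where h is the code index and
  xs ! j is the slice in which encoded segment j is sent.\<close>
type_synonym config = "nat \<Rightarrow> (nat \<times> nat list) option"

definition placements :: "nat \<Rightarrow> nat \<Rightarrow> nat list set" where
  "placements m S = {xs. distinct xs \<and> length xs = m \<and> set xs \<subseteq> {..<S}}"

definition user_pmf :: "real \<Rightarrow> nat pmf \<Rightarrow> (nat \<Rightarrow> nat) \<Rightarrow> nat \<Rightarrow> (nat \<times> nat list) option pmf" where
  "user_pmf \<pi> \<Lambda> n S =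
     bind_pmf (bernoulli_pmf \<pi>) (\<lambda>a. if a then
        bind_pmf \<Lambda> (\<lambda>h. map_pmf (\<lambda>xs. Some (h, xs)) (pmf_of_set (placements (n h) S)))
      else return_pmf None)"

definition config_pmf :: "nat \<Rightarrow> nat \<Rightarrow> real \<Rightarrow> nat pmf \<Rightarrow> (nat \<Rightarrow> nat) \<Rightarrow> config pmf" where
  "config_pmf N S \<pi> \<Lambda> n = Pi_pmf {..<N} None (\<lambda>_. user_pmf \<pi> \<Lambda> n S)"

text \<open>Edges of the bipartite user-slice graph: (user, segment index).\<close>
definition edges :: "(nat \<Rightarrow> nat) \<Rightarrow> nat \<Rightarrow> config \<Rightarrow> (nat \<times> nat) set" where
  "edges n N c = {(u, j). u < N \<and> (\<exists>h xs. c u = Some (h, xs) \<and> j < n h)}"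

definition slice_of :: "config \<Rightarrow> nat \<times> nat \<Rightarrow> nat" where
  "slice_of c e = (case c (fst e) of Some (h, xs) \<Rightarrow> xs ! snd e | None \<Rightarrow> 0)"

definition code_of :: "config \<Rightarrow> nat \<Rightarrow> nat" where
  "code_of c u = (case c u of Some (h, xs) \<Rightarrow> h | None \<Rightarrow> 0)"

text \<open>Iterative decoding as message passing on the graph.
  coll G k n N c l e: the slice-to-user message on edge e at iteration l says
  ``collision still persists'' (some other segment in that slice is not yet recovered).
  unres: the user-to-slice message on edge e (segment not recovered by local MAP erasure
  decoding from the other segments of the same user whose slices are resolved).\<close>
fun coll :: "(nat \<Rightarrow> nat \<Rightarrow> nat \<Rightarrow> bool) \<Rightarrow> nat \<Rightarrow> (nat \<Rightarrow> nat) \<Rightarrow> nat \<Rightarrow> config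
              \<Rightarrow> nat \<Rightarrow> nat \<times> nat \<Rightarrow> bool"
and unres :: "(nat \<Rightarrow> nat \<Rightarrow> nat \<Rightarrow> bool) \<Rightarrow> nat \<Rightarrow> (nat \<Rightarrow> nat) \<Rightarrow> nat \<Rightarrow> config
              \<Rightarrow> nat \<Rightarrow> nat \<times> nat \<Rightarrow> bool" where
  "coll G k n N c 0 e =
     (\<exists>e' \<in> edges n N c. e' \<noteq> e \<and> slice_of c e' = slice_of c e)"
| "coll G k n N c (Suc l) e =
     (\<exists>e' \<in> edges n N c. e' \<noteq> e \<and> slice_of c e' = slice_of c e \<and> unres G k n N c l e')"
| "unres G k n N c l (u, j) =
     (let h = code_of c u in
      \<not> map_recovers (G h) k {j'. j' < n h \<and> j' \<noteq> j \<and> \<not> coll G k n N c l (u, j')} j)"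

text \<open>Finite-length version of p_l: probability that an edge is connected to a slice node
  where a collision persists at iteration l (ratio of expected edge counts),
  for a frame of M slots (M k slices) and N = floor(alpha M) users.\<close>
definition p_fin :: "(nat \<Rightarrow> nat \<Rightarrow> nat \<Rightarrow> bool) \<Rightarrow> nat \<Rightarrow> (nat \<Rightarrow> nat) \<Rightarrow> nat pmf
                     \<Rightarrow> real \<Rightarrow> real \<Rightarrow> nat \<Rightarrow> nat \<Rightarrow> real" where
  "p_fin G k n \<Lambda> \<pi> \<alpha> M l =
     (let N = nat \<lfloor>\<alpha> * real M\<rfloor>; P = config_pmf N (M * k) \<pi> \<Lambda> n in
      measure_pmf.expectation P (\<lambda>c. real (card {e \<in> edges n N c. coll G k n N c l e}))
      / measure_pmf.expectation P (\<lambda>c. real (card (edges n N c))))"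

end

(* The decoder is analysed by planting a bounded set of users, i.e. fixing their activity, code and
   slices, while the remaining users stay independent.  Two uniform asymptotic statements drive the
   induction on the iteration: planted edges that are alone in their slices see collisions
   independently with probability p_l (slice_claim), and segments of planted users whose other edges
   are alone are unresolved independently (user_claim).

   From slices to users: the indicator that MAP decoding fails is expanded as a multilinear
   polynomial in the collision indicators.  From users to slices: the probability that no random
   user brings an unresolved segment into the given slices is expanded by inclusion-exclusion over
   sets V of offending users.  Planting V as well leaves the other users independent; up to a lower
   order term every user of V meets the given slices once and lands elsewhere in fresh slices, so
   cycles of the graph never have to be treated separately.  The terms
   with card V = s converge to the factorial moments of a Poisson variable, and Tannery's theorem
   sums the alternating series to the exponential of the recursion.

   The information function enters because adding a column to a set K raises the rank exactly when
   the symbol is not recovered from K. *)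
theory Submission
  imports Defs
begin

section \<open>Local MAP decoding and the information function\<close>

text \<open>Uniformity is what lets the induction close. The slice statement for at most r planted
  users needs the user statement for r + s planted users, for every s, and the users of V are
  averaged over afterwards. Hence both claims quantify over the planted configuration inside
  \<open>eventually\<close>, and over every bound r. They speak of several edges jointly, because
  MAP decoding couples all edges of a user and inclusion-exclusion couples several offending users;
  the law of one edge would be too weak as induction hypothesis. The expansion runs over users and
  not over segments, since users are independent while the segments of one user are not. Orders of
  magnitude, with S = M k slices: there are about (\<alpha> S / k)^s / s! sets V of size s, and each
  of their users reaches the given slices with probability O(1/S), so the s-th term stays bounded. A
  user with two constrained segments costs O(1/S^2); the spare factor 1/S is what makes dependence
  and cycles vanish in the limit.\<close>

lemma odd_card_flip:
  assumes "finite A"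
  shows "odd (card {i \<in> A. P i \<noteq> Q i}) \<longleftrightarrow> (odd (card {i \<in> A. P i}) \<noteq> odd (card {i \<in> A. Q i}))"
proof -
  have "card {i \<in> A. P i} = card {i \<in> A. P i \<and> Q i} + card {i \<in> A. P i \<and> \<not> Q i}"
    by (subst card_Un_disjoint[symmetric]) (use assms in \<open>auto intro: arg_cong[of _ _ card]\<close>)
  moreover have "card {i \<in> A. Q i} = card {i \<in> A. P i \<and> Q i} + card {i \<in> A. \<not> P i \<and> Q i}"
    by (subst card_Un_disjoint[symmetric]) (use assms in \<open>auto intro: arg_cong[of _ _ card]\<close>)
  moreover have "card {i \<in> A. P i \<noteq> Q i} = card {i \<in> A. P i \<and> \<not> Q i} + card {i \<in> A. \<not> P i \<and> Q i}"
    by (subst card_Un_disjoint[symmetric]) (use assms in \<open>auto intro: arg_cong[of _ _ card]\<close>)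
  ultimately show ?thesis by auto
qed

text \<open>Entry \<open>i\<close> of the GF(2) sum of the columns in \<open>F\<close>, the column
  counterpart of \<open>cw\<close>. Over GF(2) every linear combination is a subset sum, so the
  subsets \<open>F\<close> of a set enumerate the span of its columns.\<close>

definition colsum :: "(nat \<Rightarrow> nat \<Rightarrow> bool) \<Rightarrow> nat set \<Rightarrow> nat \<Rightarrow> bool" where
  "colsum G F i = odd (card {j \<in> F. G i j})"

lemma colsum_insert:
  assumes "finite F" "j \<notin> F"
  shows "colsum G (insert j F) i \<longleftrightarrow> (G i j \<noteq> colsum G F i)"
proof -
  have "{j' \<in> insert j F. G i j'} = (if G i j then insert j {j' \<in> F. G i j'} else {j' \<in> F. G i j'})"
    by auto
  then show ?thesis using assms by (auto simp: colsum_def)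
qed

text \<open>Both sides are the parity of the number of ones in the submatrix with rows
  \<open>U\<close> and columns \<open>F\<close>, counted by rows and by columns.\<close>

lemma odd_card_colsum:
  assumes "finite U" "finite F"
  shows "odd (card {i \<in> U. colsum G F i}) \<longleftrightarrow> odd (card {j \<in> F. cw G U j})"
proof -
  have "even (card {i \<in> U. colsum G F i}) \<longleftrightarrow> even (\<Sum>i\<in>U. card {j \<in> F. G i j})"
    unfolding colsum_def using assms(1) by (subst even_sum_iff) auto
  also have "(\<Sum>i\<in>U. card {j \<in> F. G i j}) = (\<Sum>j\<in>F. card {i \<in> U. G i j})"
    using sum.swap_restrict[OF assms, of "\<lambda>_ _. 1::nat" G]
    by simp
  also have "even (\<Sum>j\<in>F. card {i \<in> U. G i j}) \<longleftrightarrow> even (card {j \<in> F. cw G U j})"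
    unfolding cw_def using assms(2) by (subst even_sum_iff) auto
  finally show ?thesis by blast
qed

text \<open>Linear duality over GF(2): a vector outside the span of the columns in \<open>K\<close>
  is separated from that span by a linear functional. The functional is given by the message
  \<open>U\<close>, whose value on a vector is the parity of its overlap with
  \<open>U\<close>.\<close>

lemma separating_message:
  assumes "finite K" "\<And>F. F \<subseteq> K \<Longrightarrow> \<exists>i<k. v i \<noteq> colsum G F i"
  shows "\<exists>U \<subseteq> {..<k}. (\<forall>j\<in>K. \<not> cw G U j) \<and> odd (card {i \<in> U. v i})"
  using assms
proof (induction K arbitrary: v rule: finite_induct)
  case empty
  then obtain i where "i < k" "v i" by (auto simp: colsum_def)
  then have "{i' \<in> {i}. v i'} = {i}" by auto
  then show ?case using \<open>i < k\<close> by (intro exI[of _ "{i}"]) auto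
next
  case (insert a K)
  \<comment> \<open>The vector \<open>v\<close> plus column \<open>a\<close>. Neither
    \<open>v\<close> nor this sum lies in the span of the columns in \<open>K\<close>, so the
    induction hypothesis yields a message for each.\<close>
  let ?w = "\<lambda>i. v i \<noteq> G i a"
  obtain U1 where U1: "U1 \<subseteq> {..<k}" "\<forall>j\<in>K. \<not> cw G U1 j" "odd (card {i \<in> U1. v i})"
    using insert.IH[of v] insert.prems by blast
  have "\<exists>i<k. ?w i \<noteq> colsum G F i" if "F \<subseteq> K" for F
  proof -
    have "finite F" "a \<notin> F" using that insert.hyps finite_subset by auto
    then show ?thesis
      using insert.prems[of "insert a F"] that by (auto simp: colsum_insert)
  qed
  then obtain U2 where U2: "U2 \<subseteq> {..<k}" "\<forall>j\<in>K. \<not> cw G U2 j" "odd (card {i \<in> U2. ?w i})"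
    using insert.IH[of ?w] by blast
  have U2': "odd (card {i \<in> U2. v i}) \<noteq> cw G U2 a"
    using U2(3) odd_card_flip[of U2 v "\<lambda>i. G i a"] finite_subset[OF U2(1)] by (auto simp: cw_def)
  \<comment> \<open>GF(2) sum of the two messages, for the case that both have bit 1 at
    \<open>a\<close>: these bits cancel, while \<open>v\<close> has odd overlap with
    \<open>U1\<close> and even overlap with \<open>U2\<close>.\<close>
  let ?U = "{i \<in> {..<k}. (i \<in> U1) \<noteq> (i \<in> U2)}"
  have dot: "odd (card {i \<in> ?U. z i}) \<longleftrightarrow> (odd (card {i \<in> U1. z i}) \<noteq> odd (card {i \<in> U2. z i}))" for z
  proof -
    have "{i \<in> ?U. z i} = {i \<in> {..<k}. (i \<in> U1 \<and> z i) \<noteq> (i \<in> U2 \<and> z i)}" by auto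
    moreover have "{i \<in> {..<k}. i \<in> U1 \<and> z i} = {i \<in> U1. z i}" "{i \<in> {..<k}. i \<in> U2 \<and> z i} = {i \<in> U2. z i}"
      using U1(1) U2(1) by auto
    ultimately show ?thesis using odd_card_flip[of "{..<k}" "\<lambda>i. i \<in> U1 \<and> z i" "\<lambda>i. i \<in> U2 \<and> z i"] by simp
  qed
  show ?case
  proof (cases "cw G U1 a")
    case False
    then show ?thesis using U1 by blast
  next
    case True
    show ?thesis
    proof (cases "cw G U2 a")
      case False
      then show ?thesis using U2 U2' by blast
    next
      case True
      have "\<forall>j\<in>insert a K. \<not> cw G ?U j"
        using U1 U2 True \<open>cw G U1 a\<close> unfolding cw_def dot by auto
      moreover have "odd (card {i \<in> ?U. v i})"
        using U1 U2' True unfolding dot by auto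
      ultimately show ?thesis by (intro exI[of _ ?U]) auto
    qed
  qed
qed

lemma cw_empty [simp]: "\<not> cw G {} j"
  by (simp add: cw_def)

text \<open>A symbol is determined by the symbols in \<open>I\<close> exactly when its column lies
  in their span. Outside the span, duality gives two messages that only \<open>j\<close> tells
  apart; inside it, the bit at \<open>j\<close> is the parity of the bits in a subset of
  \<open>I\<close>.\<close>

lemma col_indep_insert:
  assumes "finite I" "j \<notin> I" "col_indep G k I"
  shows "col_indep G k (insert j I) \<longleftrightarrow> \<not> map_recovers G k I j"
proof
  assume ind: "col_indep G k (insert j I)"
  have "\<exists>i<k. G i j \<noteq> colsum G F i" if "F \<subseteq> I" for F
  proof -
    have "finite F" "j \<notin> F" using that assms finite_subset by auto
    moreover have "\<exists>i<k. colsum G (insert j F) i"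
      using ind[unfolded col_indep_def, rule_format, of "insert j F"] that unfolding colsum_def
      by blast
    ultimately show ?thesis by (auto simp: colsum_insert)
  qed
  from separating_message[OF assms(1) this] obtain U where
    "U \<subseteq> {..<k}" "\<forall>j\<in>I. \<not> cw G U j" "cw G U j"
    by (auto simp: cw_def)
  \<comment> \<open>The message \<open>U\<close> and the zero message \<open>{}\<close> agree on
    \<open>I\<close> and differ at \<open>j\<close>.\<close>
  then show "\<not> map_recovers G k I j"
    unfolding map_recovers_def by (metis cw_empty empty_subsetI)
next
  assume nrec: "\<not> map_recovers G k I j"
  show "col_indep G k (insert j I)"
    unfolding col_indep_def
  proof (intro allI impI)
    fix F assume F: "F \<subseteq> insert j I" "F \<noteq> {}"
    show "\<exists>i<k. odd (card {j \<in> F. G i j})"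
    proof (cases "j \<in> F")
      case False
      then show ?thesis using F assms(3) unfolding col_indep_def by blast
    next
      case True
      define F' where "F' = F - {j}"
      have F': "F = insert j F'" "j \<notin> F'" "F' \<subseteq> I" "finite F'"
        using True F assms(1) by (auto simp: F'_def intro: finite_subset)
      show ?thesis
      proof (rule ccontr)
        assume "\<not> ?thesis"
        then have eq: "G i j = colsum G F' i" if "i < k" for i
          using that F' colsum_insert[of F' j G i] by (auto simp: colsum_def)
        have cw: "cw G U j \<longleftrightarrow> odd (card {j' \<in> F'. cw G U j'})" if U: "U \<subseteq> {..<k}" for U
        proof -
          have "{i \<in> U. G i j} = {i \<in> U. colsum G F' i}" using eq U by auto
          then show ?thesis
            using odd_card_colsum[OF finite_subset[OF U] F'(4)] by (simp add: cw_def)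
        qed
        have "map_recovers G k I j"
          unfolding map_recovers_def
        proof (intro allI impI)
          fix U V assume "U \<subseteq> {..<k}" "V \<subseteq> {..<k}" and agree: "\<forall>j'\<in>I. cw G U j' = cw G V j'"
          moreover have "{j' \<in> F'. cw G U j'} = {j' \<in> F'. cw G V j'}" using agree F' by auto
          ultimately show "cw G U j = cw G V j" by (simp add: cw)
        qed
        with nrec show False by simp
      qed
    qed
  qed
qed

section \<open>Rank of column sets and recoverability\<close>

lemma map_recovers_trans:
  assumes "map_recovers G k K j" "\<And>a. a \<in> K \<Longrightarrow> map_recovers G k I a"
  shows "map_recovers G k I j"
  using assms unfolding map_recovers_def by meson

lemma map_recovers_mem: "j \<in> K \<Longrightarrow> map_recovers G k K j"
  unfolding map_recovers_def by auto

lemma map_recovers_mono: "map_recovers G k K j \<Longrightarrow> K \<subseteq> K' \<Longrightarrow> map_recovers G k K' j"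
  unfolding map_recovers_def by blast

lemma col_indep_subset: "col_indep G k I \<Longrightarrow> I' \<subseteq> I \<Longrightarrow> col_indep G k I'"
  unfolding col_indep_def by blast

lemma finite_indep_cards:
  assumes "finite J"
  shows "finite (card ` {I. I \<subseteq> J \<and> col_indep G k I})"
  using assms by simp

lemma card_le_col_rank:
  assumes "finite J" "I \<subseteq> J" "col_indep G k I"
  shows "card I \<le> col_rank G k J"
  unfolding col_rank_def using assms by (intro Max_ge) auto

lemma col_rank_witness:
  assumes "finite J"
  obtains I where "I \<subseteq> J" "col_indep G k I" "card I = col_rank G k J"
proof -
  have "col_indep G k {}" by (auto simp: col_indep_def)
  then have "card ` {I. I \<subseteq> J \<and> col_indep G k I} \<noteq> {}" by auto
  from Max_in[OF finite_indep_cards[OF assms] this] show ?thesis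
    using that unfolding col_rank_def by auto
qed

text \<open>If \<open>j\<close> is not recovered, it extends a largest independent subset of
  \<open>K\<close>. If it is recovered, a larger independent set would have to contain
  \<open>j\<close>; the rest \<open>B\<close> of it then has maximal size in \<open>K\<close>, so it
  recovers all of \<open>K\<close> and by transitivity also \<open>j\<close>, which contradicts
  independence.\<close>

lemma col_rank_insert:
  assumes "finite K" "j \<notin> K"
  shows "col_rank G k (insert j K) = col_rank G k K + of_bool (\<not> map_recovers G k K j)"
proof -
  obtain I where I: "I \<subseteq> K" "col_indep G k I" "card I = col_rank G k K"
    using col_rank_witness[OF assms(1)] by blast
  have finI: "finite I" "j \<notin> I" using I assms finite_subset by auto
  obtain I' where I': "I' \<subseteq> insert j K" "col_indep G k I'" "card I' = col_rank G k (insert j K)"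
    using col_rank_witness[of "insert j K"] assms(1) by auto
  have finI': "finite I'" using I' assms by (meson finite_insert finite_subset)
  have low: "col_rank G k K \<le> col_rank G k (insert j K)"
    using card_le_col_rank[of "insert j K" I G k] I assms(1) by auto
  have sub: "card (I' - {j}) \<le> col_rank G k K"
    using I' assms(1) by (intro card_le_col_rank col_indep_subset[OF I'(2)]) auto
  show ?thesis
  proof (cases "map_recovers G k K j")
    case False
    have "\<not> map_recovers G k I j" using False map_recovers_mono I(1) by blast
    then have "col_indep G k (insert j I)" using col_indep_insert[OF finI I(2)] by simp
    then have "card (insert j I) \<le> col_rank G k (insert j K)"
      using I(1) assms(1) by (intro card_le_col_rank) auto
    moreover have "card I' \<le> Suc (card (I' - {j}))"
      using finI' by (cases "j \<in> I'") (auto simp: card_Diff_singleton)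
    ultimately show ?thesis using False finI I I' sub by auto
  next
    case True
    have "col_rank G k (insert j K) \<le> col_rank G k K"
    proof (rule ccontr)
      assume "\<not> ?thesis"
      then have big: "card I' > col_rank G k K" using I' by simp
      have jI': "j \<in> I'" using big sub by (cases "j \<in> I'") auto
      define B where "B = I' - {j}"
      have B: "B \<subseteq> K" "finite B" "j \<notin> B" "I' = insert j B" "col_indep G k B"
        using I' finI' jI' col_indep_subset[OF I'(2)] by (auto simp: B_def)
      have cB: "card B \<ge> col_rank G k K" using big B by simp
      have "map_recovers G k B a" if "a \<in> K" for a
      proof (cases "a \<in> B")
        case True then show ?thesis by (rule map_recovers_mem)
      next
        case False
        show ?thesis
        proof (rule ccontr)
          assume "\<not> ?thesis"
          then have "col_indep G k (insert a B)" using col_indep_insert[OF B(2) False B(5)] by simp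
          then have "card (insert a B) \<le> col_rank G k K"
            using that B assms(1) by (intro card_le_col_rank) auto
          then show False using cB B False by simp
        qed
      qed
      with True have "map_recovers G k B j" by (rule map_recovers_trans)
      then show False using col_indep_insert[OF B(2,3,5)] I'(2) B(4) by simp
    qed
    then show ?thesis using low True by simp
  qed
qed

section \<open>Double counting: from recoverability to the information function\<close>

text \<open>A set of size \<open>Suc g\<close> arises as \<open>insert j K\<close> once for each of
  its elements.\<close>

lemma sum_pointed_subsets:
  fixes f :: "nat set \<Rightarrow> nat"
  shows "(\<Sum>j<n. \<Sum>K\<in>{K. K \<subseteq> {..<n} - {j} \<and> card K = g}. f (insert j K))
       = Suc g * (\<Sum>J\<in>{J. J \<subseteq> {..<n} \<and> card J = Suc g}. f J)"
proof -
  have fin: "finite {K. K \<subseteq> {..<n} - {j} \<and> card K = g}" for j by simp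
  have "(\<Sum>j<n. \<Sum>K\<in>{K. K \<subseteq> {..<n} - {j} \<and> card K = g}. f (insert j K))
      = (\<Sum>(j, K)\<in>(SIGMA j:{..<n}. {K. K \<subseteq> {..<n} - {j} \<and> card K = g}). f (insert j K))"
    by (rule sum.Sigma) auto
  also have "\<dots> = (\<Sum>(J, j)\<in>(SIGMA J:{J. J \<subseteq> {..<n} \<and> card J = Suc g}. J). f J)"
  proof (rule sum.reindex_bij_witness[of _ "\<lambda>(J, j). (j, J - {j})" "\<lambda>(j, K). (insert j K, j)"])
    fix a assume "a \<in> (SIGMA j:{..<n}. {K. K \<subseteq> {..<n} - {j} \<and> card K = g})"
    then obtain j K where a: "a = (j, K)" "j < n" "K \<subseteq> {..<n} - {j}" "card K = g" by blast
    moreover have "finite K" "j \<notin> K" using a by (auto intro: finite_subset)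
    ultimately show "(case case a of (j, K) \<Rightarrow> (insert j K, j) of (J, j) \<Rightarrow> (j, J - {j})) = a"
      and "(case a of (j, K) \<Rightarrow> (insert j K, j)) \<in> (SIGMA J:{J. J \<subseteq> {..<n} \<and> card J = Suc g}. J)"
      and "(case case a of (j, K) \<Rightarrow> (insert j K, j) of (J, j) \<Rightarrow> f J) = (case a of (j, K) \<Rightarrow> f (insert j K))"
      by auto
  next
    fix b assume "b \<in> (SIGMA J:{J. J \<subseteq> {..<n} \<and> card J = Suc g}. J)"
    then obtain J j where b: "b = (J, j)" "j \<in> J" "J \<subseteq> {..<n}" "card J = Suc g" by blast
    moreover have "finite J" using b by (auto intro: finite_subset)
    ultimately show "(case case b of (J, j) \<Rightarrow> (j, J - {j}) of (j, K) \<Rightarrow> (insert j K, j)) = b"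
      and "(case b of (J, j) \<Rightarrow> (j, J - {j})) \<in> (SIGMA j:{..<n}. {K. K \<subseteq> {..<n} - {j} \<and> card K = g})"
      by (auto simp: insert_absorb)
  qed
  also have "\<dots> = (\<Sum>J\<in>{J. J \<subseteq> {..<n} \<and> card J = Suc g}. \<Sum>j\<in>J. f J)"
    by (rule sum.Sigma[symmetric]) (auto intro: finite_subset)
  also have "\<dots> = Suc g * (\<Sum>J\<in>{J. J \<subseteq> {..<n} \<and> card J = Suc g}. f J)"
    by (simp add: sum_distrib_left)
  finally show ?thesis .
qed

text \<open>A set of size \<open>g\<close> avoids \<open>n - g\<close> of the positions.\<close>

lemma sum_copointed_subsets:
  fixes f :: "nat set \<Rightarrow> nat"
  shows "(\<Sum>j<n. \<Sum>K\<in>{K. K \<subseteq> {..<n} - {j} \<and> card K = g}. f K)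
       = (n - g) * (\<Sum>K\<in>{K. K \<subseteq> {..<n} \<and> card K = g}. f K)"
proof -
  have "(\<Sum>j<n. \<Sum>K\<in>{K. K \<subseteq> {..<n} - {j} \<and> card K = g}. f K)
      = (\<Sum>(j, K)\<in>(SIGMA j:{..<n}. {K. K \<subseteq> {..<n} - {j} \<and> card K = g}). f K)"
    by (rule sum.Sigma) auto
  also have "\<dots> = (\<Sum>(K, j)\<in>(SIGMA K:{K. K \<subseteq> {..<n} \<and> card K = g}. {..<n} - K). f K)"
    by (rule sum.reindex_bij_witness[of _ "\<lambda>(K, j). (j, K)" "\<lambda>(j, K). (K, j)"]) auto
  also have "\<dots> = (\<Sum>K\<in>{K. K \<subseteq> {..<n} \<and> card K = g}. \<Sum>j\<in>{..<n} - K. f K)"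
    by (rule sum.Sigma[symmetric]) auto
  also have "\<dots> = (\<Sum>K\<in>{K. K \<subseteq> {..<n} \<and> card K = g}. (n - g) * f K)"
    by (rule sum.cong) (auto simp: card_Diff_subset finite_subset)
  finally show ?thesis by (simp add: sum_distrib_left)
qed

text \<open>Each failure of recovery is a rank increment by \<open>col_rank_insert\<close>. Summing
  the ranks after and before the insertion gives the two multiples of the information
  function.\<close>

lemma sum_not_map_recovers:
  "real (\<Sum>j<n. \<Sum>K\<in>{K. K \<subseteq> {..<n} - {j} \<and> card K = g}. of_bool (\<not> map_recovers G k K j))
   = real (Suc g) * real (info_fun G k n (Suc g)) - real (n - g) * real (info_fun G k n g)"
proof -
  have "Suc g * info_fun G k n (Suc g)
      = (\<Sum>j<n. \<Sum>K\<in>{K. K \<subseteq> {..<n} - {j} \<and> card K = g}. col_rank G k (insert j K))"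
    unfolding info_fun_def by (rule sum_pointed_subsets[symmetric])
  also have "\<dots> = (\<Sum>j<n. \<Sum>K\<in>{K. K \<subseteq> {..<n} - {j} \<and> card K = g}.
                  col_rank G k K + of_bool (\<not> map_recovers G k K j))"
    by (intro sum.cong refl col_rank_insert) (auto intro: finite_subset)
  also have "\<dots> = (n - g) * info_fun G k n g
      + (\<Sum>j<n. \<Sum>K\<in>{K. K \<subseteq> {..<n} - {j} \<and> card K = g}. of_bool (\<not> map_recovers G k K j))"
    unfolding info_fun_def by (simp only: sum.distrib sum_copointed_subsets)
  finally have "real (Suc g * info_fun G k n (Suc g)) = real ((n - g) * info_fun G k n g
      + (\<Sum>j<n. \<Sum>K\<in>{K. K \<subseteq> {..<n} - {j} \<and> card K = g}. of_bool (\<not> map_recovers G k K j)))"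
    by (rule arg_cong)
  then show ?thesis by (simp only: of_nat_add of_nat_mult add_diff_cancel_left')
qed

text \<open>Probability that symbol \<open>j\<close> is not recovered when every other symbol is known independently
  with probability \<open>a\<close>.\<close>

definition erasure_prob :: "(nat \<Rightarrow> nat \<Rightarrow> bool) \<Rightarrow> nat \<Rightarrow> nat \<Rightarrow> real \<Rightarrow> nat \<Rightarrow> real" where
  "erasure_prob G k n a j =
     (\<Sum>K\<in>Pow ({..<n} - {j}). a ^ card K * (1 - a) ^ (n - 1 - card K) * of_bool (\<not> map_recovers G k K j))"

lemma erasure_prob_nonneg: "0 \<le> a \<Longrightarrow> a \<le> 1 \<Longrightarrow> 0 \<le> erasure_prob G k n a j"
  unfolding erasure_prob_def by (intro sum_nonneg mult_nonneg_nonneg) auto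

text \<open>Origin of the bracket in the recursion: the known sets are grouped by size, and for each
  size the failures are counted by \<open>sum_not_map_recovers\<close>. Here \<open>q\<close> plays
  the part of the probability that a symbol is still unknown.\<close>

lemma sum_erasure_prob:
  "(\<Sum>j<n. erasure_prob G k n (1 - q) j) =
   (\<Sum>t<n. q ^ t * (1 - q) ^ (n - 1 - t) *
      (real (n - t) * real (info_fun G k n (n - t)) - real (t + 1) * real (info_fun G k n (n - 1 - t))))"
proof -
  have "(\<Sum>j<n. erasure_prob G k n (1 - q) j) =
        (\<Sum>j<n. \<Sum>g<n. \<Sum>K\<in>{K. K \<subseteq> {..<n} - {j} \<and> card K = g}.
            (1 - q) ^ g * q ^ (n - 1 - g) * of_bool (\<not> map_recovers G k K j))"
  proof (rule sum.cong[OF refl])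
    fix j assume j: "j \<in> {..<n}"
    have "card K < n" if "K \<subseteq> {..<n} - {j}" for K
    proof -
      have "card K \<le> card ({..<n} - {j})" using that by (intro card_mono) auto
      then show ?thesis using j by auto
    qed
    then have "card ` Pow ({..<n} - {j}) \<subseteq> {..<n}" by auto
    from sum.group[OF _ _ this, symmetric, of "\<lambda>K. (1 - q) ^ card K * q ^ (n - 1 - card K) * of_bool (\<not> map_recovers G k K j)"]
    show "erasure_prob G k n (1 - q) j = (\<Sum>g<n. \<Sum>K\<in>{K. K \<subseteq> {..<n} - {j} \<and> card K = g}.
            (1 - q) ^ g * q ^ (n - 1 - g) * of_bool (\<not> map_recovers G k K j))"
      unfolding erasure_prob_def Pow_def mem_Collect_eq
      by (simp only: diff_diff_eq2 add_diff_cancel_left' mem_Collect_eq cong: conj_cong) (auto intro!: sum.cong)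
  qed
  also have "\<dots> = (\<Sum>g<n. (1 - q) ^ g * q ^ (n - 1 - g) *
      real (\<Sum>j<n. \<Sum>K\<in>{K. K \<subseteq> {..<n} - {j} \<and> card K = g}. of_bool (\<not> map_recovers G k K j)))"
    by (subst sum.swap) (simp only: of_nat_sum of_nat_of_bool sum_distrib_left)
  also have "\<dots> = (\<Sum>g<n. (1 - q) ^ g * q ^ (n - 1 - g) *
      (real (Suc g) * real (info_fun G k n (Suc g)) - real (n - g) * real (info_fun G k n g)))"
    by (simp only: sum_not_map_recovers)
  also have "\<dots> = (\<Sum>t<n. q ^ t * (1 - q) ^ (n - 1 - t) *
      (real (n - t) * real (info_fun G k n (n - t)) - real (t + 1) * real (info_fun G k n (n - 1 - t))))"
    \<comment> \<open>When \<open>g\<close> of the other \<open>n - 1\<close> symbols are known,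
      \<open>t = n - 1 - g\<close> of them are unknown.\<close>
    by (rule sum.reindex_bij_witness[of _ "\<lambda>t. n - 1 - t" "\<lambda>t. n - 1 - t"])
       (auto simp: Suc_diff_Suc algebra_simps of_nat_diff)
  finally show ?thesis .
qed

section \<open>Random placements and users\<close>

abbreviation expect :: "'a pmf \<Rightarrow> ('a \<Rightarrow> real) \<Rightarrow> real" where
  "expect \<equiv> measure_pmf.expectation"

lemma expect_mono:
  assumes "finite (set_pmf p)" "\<And>x. x \<in> set_pmf p \<Longrightarrow> f x \<le> g x"
  shows "expect p f \<le> expect p g"
  using assms by (intro integral_mono_AE integrable_measure_pmf_finite) (auto simp: AE_measure_pmf_iff)

lemma expect_cong: "(\<And>x. x \<in> set_pmf p \<Longrightarrow> f x = g x) \<Longrightarrow> expect p f = expect p g"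
  by (intro integral_cong_AE) (auto simp: AE_measure_pmf_iff)

lemma expect_sum:
  "finite (set_pmf p) \<Longrightarrow> expect p (\<lambda>x. \<Sum>i\<in>I. f i x) = (\<Sum>i\<in>I. expect p (f i))"
  by (intro Bochner_Integration.integral_sum integrable_measure_pmf_finite)

lemma expect_add:
  "finite (set_pmf p) \<Longrightarrow> expect p (\<lambda>x. f x + g x) = expect p f + expect p g"
  by (intro Bochner_Integration.integral_add integrable_measure_pmf_finite)

lemma expect_diff:
  "finite (set_pmf p) \<Longrightarrow> expect p (\<lambda>x. f x - g x) = expect p f - expect p g"
  by (intro Bochner_Integration.integral_diff integrable_measure_pmf_finite)

lemma expect_of_bool_bounds: "0 \<le> expect p (\<lambda>x. of_bool (P x))" "expect p (\<lambda>x. of_bool (P x)) \<le> 1"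
proof -
  show "0 \<le> expect p (\<lambda>x. of_bool (P x))" by (intro integral_nonneg_AE) auto
  show "expect p (\<lambda>x. of_bool (P x)) \<le> 1"
    by (rule measure_pmf.integral_le_const) (auto intro!: measure_pmf.integrable_const_bound[where B = 1])
qed

lemma abs_expect_diff_le:
  assumes "finite (set_pmf p)" "\<And>x. x \<in> set_pmf p \<Longrightarrow> \<bar>f x - g x\<bar> \<le> h x"
  shows "\<bar>expect p f - expect p g\<bar> \<le> expect p h"
proof -
  have "\<bar>expect p (\<lambda>x. f x - g x)\<bar> \<le> expect p (\<lambda>x. \<bar>f x - g x\<bar>)" by (rule integral_abs_bound)
  also have "\<dots> \<le> expect p h" using assms by (rule expect_mono)
  finally show ?thesis using assms(1) by (simp add: expect_diff)
qed

lemma expect_pair: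
  assumes "finite (set_pmf p)" "finite (set_pmf q)"
  shows "expect (pair_pmf p q) F = expect p (\<lambda>a. expect q (\<lambda>b. F (a, b)))"
proof -
  have "expect (pair_pmf p q) F
      = (\<Sum>a\<in>set_pmf p. pmf p a *\<^sub>R expect (bind_pmf q (\<lambda>b. return_pmf (a, b))) F)"
    unfolding pair_pmf_def using assms by (intro pmf_expectation_bind) auto
  also have "\<dots> = (\<Sum>a\<in>set_pmf p. pmf p a *\<^sub>R expect q (\<lambda>b. F (a, b)))"
    by (simp flip: map_pmf_def)
  also have "\<dots> = expect p (\<lambda>a. expect q (\<lambda>b. F (a, b)))"
    using assms by (intro integral_measure_pmf[symmetric]) auto
  finally show ?thesis .
qed

lemma finite_set_Pi_pmf:
  assumes "finite A" "\<And>x. x \<in> A \<Longrightarrow> finite (set_pmf (p x))"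
  shows "finite (set_pmf (Pi_pmf A d p))"
  using assms by (simp add: set_Pi_pmf finite_PiE_dflt)

lemma expect_Pi_pmf_union:
  assumes "finite A" "finite B" "A \<inter> B = {}" "\<And>x. x \<in> A \<union> B \<Longrightarrow> finite (set_pmf (p x))"
  shows "expect (Pi_pmf (A \<union> B) d p) F
       = expect (Pi_pmf A d p) (\<lambda>x. expect (Pi_pmf B d p) (\<lambda>c. F (override_on c x A)))"
proof -
  have "finite (set_pmf (Pi_pmf A d p))" "finite (set_pmf (Pi_pmf B d p))"
    using assms by (auto intro!: finite_set_Pi_pmf)
  then show ?thesis
    by (subst Pi_pmf_union[OF assms(1-3)]) (simp add: expect_pair override_on_def)
qed

lemma expect_prod_Pi_pmf:
  fixes f :: "'a \<Rightarrow> 'b \<Rightarrow> real"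
  assumes "finite A" "\<And>x. x \<in> A \<Longrightarrow> finite (set_pmf (p x))"
    and "\<And>x y. x \<in> A \<Longrightarrow> y \<in> set_pmf (p x) \<Longrightarrow> 0 \<le> f x y"
  shows "expect (Pi_pmf A d p) (\<lambda>y. \<Prod>x\<in>A. f x (y x)) = (\<Prod>x\<in>A. expect (p x) (f x))"
  using assms by (intro expectation_prod_Pi_pmf integrable_measure_pmf_finite)

section \<open>Uniform placements of segments in distinct slices\<close>

lemma finite_placements: "finite (placements m S)"
  by (rule finite_subset[OF _ finite_lists_length_eq[of "{..<S}" m]]) (auto simp: placements_def)

lemma placements_nonempty: "m \<le> S \<Longrightarrow> placements m S \<noteq> {}"
  by (auto simp: placements_def intro!: exI[of _ "[0..<m]"])

lemma placements_nth: "xs \<in> placements m S \<Longrightarrow> j < m \<Longrightarrow> xs ! j < S"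
  unfolding placements_def using nth_mem by blast

lemma placements_nth_neq: "xs \<in> placements m S \<Longrightarrow> j < m \<Longrightarrow> j' < m \<Longrightarrow> j \<noteq> j' \<Longrightarrow> xs ! j \<noteq> xs ! j'"
  by (simp add: placements_def nth_eq_iff_index_eq)

text \<open>Exchanging two slices is an involution on placements. This symmetry replaces explicit
  counting: it shows that all slices are equally likely for a segment, and all remaining slices for
  a second one.\<close>

lemma card_placements_transpose:
  assumes "a < S" "b < S"
  shows "card {xs \<in> placements m S. Q xs} = card {xs \<in> placements m S. Q (map (Transposition.transpose a b) xs)}"
proof (rule bij_betw_same_card[symmetric])
  have mem: "map (Transposition.transpose a b) xs \<in> placements m S" if "xs \<in> placements m S" for xs
    using that assms by (auto simp: placements_def distinct_map subset_iff Transposition.transpose_def)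
  have inv: "map (Transposition.transpose a b) (map (Transposition.transpose a b) xs) = xs" for xs
    by (simp add: o_def)
  show "bij_betw (map (Transposition.transpose a b)) {xs \<in> placements m S. Q (map (Transposition.transpose a b) xs)} {xs \<in> placements m S. Q xs}"
    by (rule bij_betwI[where g = "map (Transposition.transpose a b)"]) (use mem inv in auto)
qed

lemma card_placements_at:
  assumes "j < m" "s < S"
  shows "S * card {xs \<in> placements m S. xs ! j = s} = card (placements m S)"
proof -
  have "card {xs \<in> placements m S. xs ! j = s'} = card {xs \<in> placements m S. xs ! j = s}" if "s' < S" for s'
  proof -
    have "{xs \<in> placements m S. map (Transposition.transpose s s') xs ! j = s'} = {xs \<in> placements m S. xs ! j = s}"
      using assms(1) by (auto simp: placements_def transpose_eq_iff)
    then show ?thesis using card_placements_transpose[OF assms(2) that, of m "\<lambda>xs. xs ! j = s'"] by simp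
  qed
  then have "S * card {xs \<in> placements m S. xs ! j = s} = (\<Sum>s'<S. card {xs \<in> placements m S. xs ! j = s'})"
    by simp
  also have "\<dots> = card (\<Union>s'<S. {xs \<in> placements m S. xs ! j = s'})"
    by (rule card_UN_disjoint[symmetric]) (auto simp: finite_placements)
  also have "(\<Union>s'<S. {xs \<in> placements m S. xs ! j = s'}) = placements m S"
    using placements_nth[OF _ assms(1)] by auto
  finally show ?thesis .
qed

lemma card_placements_at2:
  assumes "j < m" "j' < m" "j \<noteq> j'" "s < S" "s' < S" "s \<noteq> s'"
  shows "S * ((S - 1) * card {xs \<in> placements m S. xs ! j = s \<and> xs ! j' = s'}) = card (placements m S)"
proof -
  have "card {xs \<in> placements m S. xs ! j = s \<and> xs ! j' = r} = card {xs \<in> placements m S. xs ! j = s \<and> xs ! j' = s'}"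
    if "r \<in> {..<S} - {s}" for r
  proof -
    \<comment> \<open>The transposition of \<open>s'\<close> and \<open>r\<close> fixes
      \<open>s\<close>, so the condition on segment \<open>j\<close> is preserved.\<close>
    have "{xs \<in> placements m S. map (Transposition.transpose s' r) xs ! j = s \<and> map (Transposition.transpose s' r) xs ! j' = r}
        = {xs \<in> placements m S. xs ! j = s \<and> xs ! j' = s'}"
      using assms that by (auto simp: placements_def transpose_eq_iff)
    then show ?thesis
      using card_placements_transpose[of s' S r m "\<lambda>xs. xs ! j = s \<and> xs ! j' = r"] that assms by simp
  qed
  then have "(\<Sum>r\<in>{..<S} - {s}. card {xs \<in> placements m S. xs ! j = s \<and> xs ! j' = r})
      = (\<Sum>r\<in>{..<S} - {s}. card {xs \<in> placements m S. xs ! j = s \<and> xs ! j' = s'})"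
    by (intro sum.cong refl)
  then have "(S - 1) * card {xs \<in> placements m S. xs ! j = s \<and> xs ! j' = s'}
      = (\<Sum>r\<in>{..<S} - {s}. card {xs \<in> placements m S. xs ! j = s \<and> xs ! j' = r})"
    using assms(4) by (simp only: sum_constant) simp
  also have "\<dots> = card (\<Union>r\<in>{..<S} - {s}. {xs \<in> placements m S. xs ! j = s \<and> xs ! j' = r})"
    by (rule card_UN_disjoint[symmetric]) (auto simp: finite_placements)
  also have "(\<Union>r\<in>{..<S} - {s}. {xs \<in> placements m S. xs ! j = s \<and> xs ! j' = r}) = {xs \<in> placements m S. xs ! j = s}"
  proof -
    have "xs ! j' < S" "xs ! j' \<noteq> xs ! j" if "xs \<in> placements m S" for xs
      using placements_nth[OF that assms(2)] placements_nth_neq[OF that assms(1-3)] by auto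
    then show ?thesis by auto
  qed
  finally show ?thesis using card_placements_at[of j m s S] assms by simp
qed

lemma placement_in_prob:
  assumes "j < m" "m \<le> S" "T \<subseteq> {..<S}"
  shows "(\<Sum>xs\<in>placements m S. of_bool (xs ! j \<in> T)) / real (card (placements m S)) = real (card T) / real S"
proof -
  have fT: "finite T" using assms(3) finite_subset by blast
  have "(\<Sum>xs\<in>placements m S. of_bool (xs ! j \<in> T)) = (\<Sum>xs\<in>placements m S. \<Sum>s\<in>T. of_bool (xs ! j = s) :: real)"
    using fT by (intro sum.cong refl) (simp add: of_bool_def)
  also have "\<dots> = (\<Sum>s\<in>T. real (card {xs \<in> placements m S. xs ! j = s}))"
    by (subst sum.swap) (simp add: finite_placements Int_def)
  also have "\<dots> = (\<Sum>s\<in>T. real (card (placements m S)) / real S)"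
  proof (rule sum.cong[OF refl])
    fix s assume "s \<in> T"
    then have "s < S" using assms(3) by auto
    then show "real (card {xs \<in> placements m S. xs ! j = s}) = real (card (placements m S)) / real S"
      using card_placements_at[OF assms(1), of s S] by (simp add: field_simps flip: of_nat_mult)
  qed
  finally have eq: "(\<Sum>xs\<in>placements m S. of_bool (xs ! j \<in> T)) = real (card T) * (real (card (placements m S)) / real S)"
    by simp
  show ?thesis using placements_nonempty[OF assms(2)] finite_placements[of m S] unfolding eq by (simp add: field_simps)
qed

text \<open>Only an inequality, because pairs with \<open>s = s'\<close> contribute nothing: the
  segments of a user lie in distinct slices.\<close>

lemma placement_in2_prob:
  assumes "j < m" "j' < m" "j \<noteq> j'" "m \<le> S" "T \<subseteq> {..<S}" "Z \<subseteq> {..<S}"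
  shows "(\<Sum>xs\<in>placements m S. of_bool (xs ! j \<in> T \<and> xs ! j' \<in> Z)) / real (card (placements m S))
       \<le> real (card T) * real (card Z) / (real S * real (S - 1))"
proof -
  have fin: "finite T" "finite Z" using assms(5,6) finite_subset by blast+
  have S2: "S \<ge> 2" using assms by linarith
  have "(\<Sum>xs\<in>placements m S. of_bool (xs ! j \<in> T \<and> xs ! j' \<in> Z))
      = (\<Sum>xs\<in>placements m S. \<Sum>(s, s')\<in>T \<times> Z. of_bool (xs ! j = s \<and> xs ! j' = s') :: real)"
  proof (rule sum.cong[OF refl])
    fix xs
    have "(\<Sum>(s, s')\<in>T \<times> Z. of_bool (xs ! j = s \<and> xs ! j' = s') :: real)
        = (\<Sum>z\<in>T \<times> Z. of_bool (z = (xs ! j, xs ! j')))"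
      by (rule sum.cong) auto
    then show "of_bool (xs ! j \<in> T \<and> xs ! j' \<in> Z) = (\<Sum>(s, s')\<in>T \<times> Z. of_bool (xs ! j = s \<and> xs ! j' = s') :: real)"
      using fin by (simp add: of_bool_def)
  qed
  also have "\<dots> = (\<Sum>(s, s')\<in>T \<times> Z. real (card {xs \<in> placements m S. xs ! j = s \<and> xs ! j' = s'}))"
    by (subst sum.swap) (simp add: finite_placements Int_def case_prod_unfold)
  also have "\<dots> \<le> (\<Sum>(s, s')\<in>T \<times> Z. real (card (placements m S)) / (real S * real (S - 1)))"
  proof (rule sum_mono, clarify)
    fix s s' assume "s \<in> T" "s' \<in> Z"
    then have ss: "s < S" "s' < S" using assms by auto
    show "real (card {xs \<in> placements m S. xs ! j = s \<and> xs ! j' = s'}) \<le> real (card (placements m S)) / (real S * real (S - 1))"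
    proof (cases "s = s'")
      case True
      then have empty: "{xs \<in> placements m S. xs ! j = s \<and> xs ! j' = s'} = {}"
        by (auto dest: placements_nth_neq[OF _ assms(1-3)])
      show ?thesis unfolding empty by simp
    next
      case False
      have "real (card (placements m S)) = real S * (real (S - 1) * real (card {xs \<in> placements m S. xs ! j = s \<and> xs ! j' = s'}))"
        using card_placements_at2[OF assms(1-3) ss False] by (simp flip: of_nat_mult)
      then show ?thesis using S2 by simp
    qed
  qed
  finally have le: "(\<Sum>xs\<in>placements m S. of_bool (xs ! j \<in> T \<and> xs ! j' \<in> Z))
     \<le> real (card T) * real (card Z) * (real (card (placements m S)) / (real S * real (S - 1)))"
    by (simp add: card_cartesian_product case_prod_unfold)
  have "0 < card (placements m S)" using placements_nonempty[OF assms(4)] finite_placements by (simp add: card_gt_0_iff)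
  with le show ?thesis by (simp add: field_simps)
qed

section \<open>One random user: which slices it reaches\<close>

locale csa =
  fixes k \<theta> :: nat and n :: "nat \<Rightarrow> nat" and G :: "nat \<Rightarrow> nat \<Rightarrow> nat \<Rightarrow> bool"
    and \<Lambda> :: "nat pmf" and \<pi> \<alpha> :: real
  assumes k_pos: "k \<ge> 1" and codes: "set_pmf \<Lambda> \<subseteq> {..<\<theta>}"
    and activity: "0 < \<pi>" "\<pi> \<le> 1" and load: "0 < \<alpha>"
begin

text \<open>Any common bound for the code lengths will do; the sum is simpler to handle than the
  maximum.\<close>

definition D :: nat where "D = (\<Sum>h<\<theta>. n h)"

lemma n_le_D: "h < \<theta> \<Longrightarrow> n h \<le> D"
  unfolding D_def by (rule member_le_sum) auto

abbreviation user :: "nat \<Rightarrow> (nat \<times> nat list) option pmf" where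
  "user S \<equiv> user_pmf \<pi> \<Lambda> n S"

definition valid :: "nat \<Rightarrow> (nat \<times> nat list) option \<Rightarrow> bool" where
  "valid S v = (\<forall>h xs. v = Some (h, xs) \<longrightarrow> h < \<theta> \<and> xs \<in> placements (n h) S)"

lemma set_user: 
  assumes "D \<le> S"
  shows "set_pmf (user S) \<subseteq> insert None (Some ` (SIGMA h:{..<\<theta>}. placements (n h) S))"
proof -
  have "set_pmf (pmf_of_set (placements (n h) S)) = placements (n h) S" if "h \<in> set_pmf \<Lambda>" for h
    using that codes n_le_D[of h] assms by (intro set_pmf_of_set placements_nonempty finite_placements) auto
  then show ?thesis using codes
    unfolding user_pmf_def by (auto split: if_splits intro!: imageI)
qed

lemma finite_set_user: "D \<le> S \<Longrightarrow> finite (set_pmf (user S))"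
  by (rule finite_subset[OF set_user]) (auto simp: finite_placements)

lemma valid_user: "D \<le> S \<Longrightarrow> v \<in> set_pmf (user S) \<Longrightarrow> valid S v"
  using set_user[of S] by (auto simp: valid_def)

lemma expect_user:
  assumes "D \<le> S"
  shows "expect (user S) F = (1 - \<pi>) * F None +
    \<pi> * (\<Sum>h<\<theta>. pmf \<Lambda> h * ((\<Sum>xs\<in>placements (n h) S. F (Some (h, xs))) / real (card (placements (n h) S))))"
proof -
  let ?act = "bind_pmf \<Lambda> (\<lambda>h. map_pmf (\<lambda>xs. Some (h, xs)) (pmf_of_set (placements (n h) S)))"
  have ne: "placements (n h) S \<noteq> {}" if "h < \<theta>" for h
    using n_le_D[OF that] assms by (intro placements_nonempty) auto
  have fin: "finite (set_pmf (map_pmf (\<lambda>xs. Some (h, xs)) (pmf_of_set (placements (n h) S))))" if "h < \<theta>" for h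
    using ne[OF that] finite_placements by auto
  have act: "expect ?act F = (\<Sum>h<\<theta>. pmf \<Lambda> h * ((\<Sum>xs\<in>placements (n h) S. F (Some (h, xs))) / real (card (placements (n h) S))))"
    by (subst pmf_expectation_bind[of "{..<\<theta>}"])
       (use codes fin in \<open>auto simp: integral_pmf_of_set ne finite_placements\<close>)
  have finact: "finite (set_pmf ?act)"
    using codes fin by (auto intro: finite_subset[OF codes])
  have "expect (user S) F = (\<Sum>a\<in>UNIV. pmf (bernoulli_pmf \<pi>) a *\<^sub>R expect (if a then ?act else return_pmf None) F)"
    unfolding user_pmf_def using finact by (intro pmf_expectation_bind) auto
  then show ?thesis using activity by (simp add: UNIV_bool act)
qed

text \<open>Number of segments in \<open>T\<close>, weighted by \<open>f\<close>. In the induction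
  \<open>f h j\<close> is the limiting probability that segment \<open>j\<close> of a user with code
  \<open>h\<close> is unresolved, so the score approximates the probability that a user with just
  one segment in \<open>T\<close> offends there.\<close>

definition score :: "nat set \<Rightarrow> (nat \<Rightarrow> nat \<Rightarrow> real) \<Rightarrow> (nat \<times> nat list) option \<Rightarrow> real" where
  "score T f v = (case v of None \<Rightarrow> 0 | Some (h, xs) \<Rightarrow> \<Sum>j<n h. of_bool (xs ! j \<in> T) * f h j)"

text \<open>Expected score when \<open>T\<close> consists of all slices; for \<open>f = 1\<close> it
  is the mean number of segments sent by a user.\<close>

definition mean_score :: "(nat \<Rightarrow> nat \<Rightarrow> real) \<Rightarrow> real" where
  "mean_score f = \<pi> * (\<Sum>h<\<theta>. pmf \<Lambda> h * (\<Sum>j<n h. f h j))"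

lemma mean_score_nonneg: "(\<And>h j. 0 \<le> f h j) \<Longrightarrow> 0 \<le> mean_score f"
  unfolding mean_score_def using activity by (intro mult_nonneg_nonneg sum_nonneg) auto

text \<open>The score is a sum over segments, so only the uniform position of each single segment
  enters. The value is exact although the segments of a user are dependent.\<close>

lemma expect_score:
  assumes "D \<le> S" "T \<subseteq> {..<S}"
  shows "expect (user S) (score T f) = real (card T) / real S * mean_score f"
proof -
  have "(\<Sum>xs\<in>placements (n h) S. \<Sum>j<n h. of_bool (xs ! j \<in> T) * f h j) / real (card (placements (n h) S))
      = real (card T) / real S * (\<Sum>j<n h. f h j)" if "h < \<theta>" for h
  proof -
    have nS: "n h \<le> S" using n_le_D[OF that] assms(1) by simp
    have "(\<Sum>xs\<in>placements (n h) S. \<Sum>j<n h. of_bool (xs ! j \<in> T) * f h j) / real (card (placements (n h) S))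
       = (\<Sum>j<n h. ((\<Sum>xs\<in>placements (n h) S. of_bool (xs ! j \<in> T)) / real (card (placements (n h) S))) * f h j)"
      by (subst sum.swap) (simp only: sum_distrib_right sum_divide_distrib times_divide_eq_left)
    also have "\<dots> = (\<Sum>j<n h. real (card T) / real S * f h j)"
      using nS assms(2) by (intro sum.cong refl) (simp only: placement_in_prob lessThan_iff)
    finally show ?thesis by (simp only: sum_distrib_left)
  qed
  then have "(\<Sum>h<\<theta>. pmf \<Lambda> h * ((\<Sum>xs\<in>placements (n h) S. score T f (Some (h, xs))) / real (card (placements (n h) S))))
      = (\<Sum>h<\<theta>. pmf \<Lambda> h * (real (card T) / real S * (\<Sum>j<n h. f h j)))"
    unfolding score_def by (intro sum.cong refl) simp
  also have "\<dots> = real (card T) / real S * (\<Sum>h<\<theta>. pmf \<Lambda> h * (\<Sum>j<n h. f h j))"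
    by (subst sum_distrib_left) (simp only: mult.left_commute)
  finally show ?thesis unfolding expect_user[OF assms(1)] mean_score_def by (simp add: score_def)
qed

definition hits :: "nat set \<Rightarrow> (nat \<times> nat list) option \<Rightarrow> bool" where
  "hits T v = (\<exists>h xs j. v = Some (h, xs) \<and> j < n h \<and> xs ! j \<in> T)"

text \<open>The exceptional event for an offending user: one segment in \<open>T\<close> and a
  different one in a set \<open>Z\<close> of already used slices.\<close>

definition hits2 :: "nat set \<Rightarrow> nat set \<Rightarrow> (nat \<times> nat list) option \<Rightarrow> bool" where
  "hits2 T Z v = (\<exists>h xs j j'. v = Some (h, xs) \<and> j < n h \<and> j' < n h \<and> j \<noteq> j' \<and> xs ! j \<in> T \<and> xs ! j' \<in> Z)"

lemma sum_pmf_codes: "(\<Sum>h<\<theta>. pmf \<Lambda> h) = 1"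
  using codes by (intro sum_pmf_eq_1) auto

lemma mean_score_le:
  assumes "\<And>h. h < \<theta> \<Longrightarrow> (\<Sum>j<n h. f h j) \<le> b" "0 \<le> b"
  shows "mean_score f \<le> b"
proof -
  have "(\<Sum>h<\<theta>. pmf \<Lambda> h * (\<Sum>j<n h. f h j)) \<le> (\<Sum>h<\<theta>. pmf \<Lambda> h * b)"
    using assms by (intro sum_mono mult_left_mono) auto
  also have "\<dots> = b" by (simp add: sum_pmf_codes flip: sum_distrib_right)
  finally have "mean_score f \<le> \<pi> * b" unfolding mean_score_def using activity by simp
  also have "\<dots> \<le> b" using activity assms(2) by (simp add: mult_left_le_one_le)
  finally show ?thesis .
qed

lemma expect_hits_le:
  assumes "D \<le> S" "T \<subseteq> {..<S}"
  shows "expect (user S) (\<lambda>v. of_bool (hits T v)) \<le> real D * real (card T) / real S"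
proof -
  have "expect (user S) (\<lambda>v. of_bool (hits T v)) \<le> expect (user S) (score T (\<lambda>_ _. 1))"
  proof (rule expect_mono[OF finite_set_user[OF assms(1)]])
    fix v
    have "1 \<le> (\<Sum>j<n h. of_bool (xs ! j \<in> T) :: real)" if "j < n h" "xs ! j \<in> T" for h j and xs :: "nat list"
      using member_le_sum[of j "{..<n h}" "\<lambda>j. of_bool (xs ! j \<in> T) :: real"] that by simp
    then show "of_bool (hits T v) \<le> score T (\<lambda>_ _. 1) v"
      by (cases "hits T v") (auto simp: hits_def score_def split: option.split intro!: sum_nonneg)
  qed
  also have "\<dots> = real (card T) / real S * mean_score (\<lambda>_ _. 1)" by (rule expect_score[OF assms])
  also have "\<dots> \<le> real (card T) / real S * real D"
    using n_le_D by (intro mult_left_mono mean_score_le) auto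
  finally show ?thesis by (simp add: mult.commute)
qed

text \<open>Union bound over the pairs of segments, at most \<open>D\<close> squared in number. The
  order 1/S^2, compared with 1/S for a single hit, is the gain that removes these users from the
  limit.\<close>

lemma expect_hits2_le:
  assumes "D \<le> S" "T \<subseteq> {..<S}" "Z \<subseteq> {..<S}"
  shows "expect (user S) (\<lambda>v. of_bool (hits2 T Z v))
       \<le> (real D)\<^sup>2 * real (card T) * real (card Z) / (real S * real (S - 1))"
proof -
  let ?B = "(real D)\<^sup>2 * (real (card T) * real (card Z) / (real S * real (S - 1)))"
  have "(\<Sum>xs\<in>placements (n h) S. of_bool (hits2 T Z (Some (h, xs)))) / real (card (placements (n h) S)) \<le> ?B"
    if h: "h < \<theta>" for h
  proof -
    have nS: "n h \<le> S" using n_le_D[OF h] assms(1) by simp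
    let ?J = "{(j, j') \<in> {..<n h} \<times> {..<n h}. j \<noteq> j'}"
    have finJ: "finite ?J" by (rule finite_subset[of _ "{..<n h} \<times> {..<n h}"]) auto
    have "card ?J \<le> card ({..<n h} \<times> {..<n h})" by (rule card_mono) auto
    also have "\<dots> \<le> D * D" using n_le_D[OF h] by (simp add: card_cartesian_product mult_le_mono)
    finally have cJ: "real (card ?J) \<le> (real D)\<^sup>2" by (simp add: power2_eq_square flip: of_nat_mult)
    have "(\<Sum>xs\<in>placements (n h) S. of_bool (hits2 T Z (Some (h, xs))))
       \<le> (\<Sum>xs\<in>placements (n h) S. \<Sum>(j, j')\<in>?J. of_bool (xs ! j \<in> T \<and> xs ! j' \<in> Z) :: real)"
    proof (rule sum_mono)
      fix xs
      have nn: "0 \<le> (\<Sum>(j, j')\<in>?J. of_bool (xs ! j \<in> T \<and> xs ! j' \<in> Z) :: real)"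
        by (rule sum_nonneg) auto
      show "of_bool (hits2 T Z (Some (h, xs))) \<le> (\<Sum>(j, j')\<in>?J. of_bool (xs ! j \<in> T \<and> xs ! j' \<in> Z) :: real)"
      proof (cases "hits2 T Z (Some (h, xs))")
        case True
        then obtain j j' where "(j, j') \<in> ?J" "xs ! j \<in> T \<and> xs ! j' \<in> Z" by (auto simp: hits2_def)
        then show ?thesis
          using member_le_sum[of "(j, j')" ?J "\<lambda>(j, j'). of_bool (xs ! j \<in> T \<and> xs ! j' \<in> Z) :: real"] finJ True
          by auto
      qed (use nn in simp)
    qed
    also have "\<dots> = (\<Sum>(j, j')\<in>?J. \<Sum>xs\<in>placements (n h) S. of_bool (xs ! j \<in> T \<and> xs ! j' \<in> Z))"
      by (subst sum.swap) (simp add: case_prod_unfold)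
    finally have "(\<Sum>xs\<in>placements (n h) S. of_bool (hits2 T Z (Some (h, xs)))) / real (card (placements (n h) S))
       \<le> (\<Sum>(j, j')\<in>?J. \<Sum>xs\<in>placements (n h) S. of_bool (xs ! j \<in> T \<and> xs ! j' \<in> Z)) / real (card (placements (n h) S))"
      by (rule divide_right_mono) simp
    also have "\<dots> = (\<Sum>(j, j')\<in>?J. (\<Sum>xs\<in>placements (n h) S. of_bool (xs ! j \<in> T \<and> xs ! j' \<in> Z)) / real (card (placements (n h) S)))"
      by (simp add: sum_divide_distrib case_prod_unfold)
    also have "\<dots> \<le> (\<Sum>(j, j')\<in>?J. real (card T) * real (card Z) / (real S * real (S - 1)))"
      by (intro sum_mono, clarify, intro placement_in2_prob[OF _ _ _ nS assms(2,3)]) auto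
    also have "\<dots> = real (card ?J) * (real (card T) * real (card Z) / (real S * real (S - 1)))"
      by (simp add: case_prod_unfold)
    also have "\<dots> \<le> ?B" using cJ by (intro mult_right_mono) auto
    finally show ?thesis .
  qed
  then have "(\<Sum>h<\<theta>. pmf \<Lambda> h * ((\<Sum>xs\<in>placements (n h) S. of_bool (hits2 T Z (Some (h, xs)))) / real (card (placements (n h) S))))
     \<le> (\<Sum>h<\<theta>. pmf \<Lambda> h * ?B)"
    by (intro sum_mono mult_left_mono) auto
  also have "\<dots> = ?B" by (simp only: sum_distrib_right[symmetric] sum_pmf_codes mult_1)
  finally have le: "(\<Sum>h<\<theta>. pmf \<Lambda> h * ((\<Sum>xs\<in>placements (n h) S. of_bool (hits2 T Z (Some (h, xs)))) / real (card (placements (n h) S)))) \<le> ?B" .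
  have "expect (user S) (\<lambda>v. of_bool (hits2 T Z v)) \<le> \<pi> * ?B"
    unfolding expect_user[OF assms(1)] using mult_left_mono[OF le, of \<pi>] activity by (simp add: hits2_def del: of_bool_conj)
  also have "\<dots> \<le> ?B" using activity by (intro mult_left_le_one_le) auto
  finally show ?thesis by (simp add: mult.assoc)
qed

end

section \<open>Planted users\<close>

text \<open>Holds for arbitrary reals, so the same monomials describe the polynomial at collision
  indicators and at the constant probability \<open>a\<close>; this permits a comparison monomial by
  monomial.\<close>

lemma multilinear_expand:
  fixes x :: "'a \<Rightarrow> real"
  assumes "finite B"
  shows "(\<Sum>L\<in>Pow B. \<phi> L * ((\<Prod>b\<in>L. x b) * (\<Prod>b\<in>B - L. 1 - x b)))
       = (\<Sum>(L, T)\<in>(SIGMA L:Pow B. Pow (B - L)). \<phi> L * (-1) ^ card T * (\<Prod>b\<in>L \<union> T. x b))"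
proof -
  have "(\<Sum>L\<in>Pow B. \<phi> L * ((\<Prod>b\<in>L. x b) * (\<Prod>b\<in>B - L. 1 - x b)))
      = (\<Sum>L\<in>Pow B. \<Sum>T\<in>Pow (B - L). \<phi> L * (-1) ^ card T * (\<Prod>b\<in>L \<union> T. x b))"
  proof (rule sum.cong[OF refl])
    fix L assume L: "L \<in> Pow B"
    have fin: "finite L" "finite (B - L)" using L assms finite_subset by auto
    have "\<phi> L * ((\<Prod>b\<in>L. x b) * (\<Prod>b\<in>B - L. 1 - x b))
        = (\<Sum>T\<in>Pow (B - L). \<phi> L * ((\<Prod>b\<in>L. x b) * ((-1) ^ card T * (\<Prod>b\<in>T. x b))))"
      by (subst prod_diff_conv_sum[OF fin(2)]) (simp add: sum_distrib_left)
    also have "\<dots> = (\<Sum>T\<in>Pow (B - L). \<phi> L * (-1) ^ card T * (\<Prod>b\<in>L \<union> T. x b))"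
    proof (rule sum.cong[OF refl])
      fix T assume "T \<in> Pow (B - L)"
      then have "(\<Prod>b\<in>L \<union> T. x b) = (\<Prod>b\<in>L. x b) * (\<Prod>b\<in>T. x b)"
        using fin by (intro prod.union_disjoint) (auto intro: finite_subset)
      then show "\<phi> L * ((\<Prod>b\<in>L. x b) * ((-1) ^ card T * (\<Prod>b\<in>T. x b))) = \<phi> L * (-1) ^ card T * (\<Prod>b\<in>L \<union> T. x b)"
        by simp
    qed
    finally show "\<phi> L * ((\<Prod>b\<in>L. x b) * (\<Prod>b\<in>B - L. 1 - x b))
        = (\<Sum>T\<in>Pow (B - L). \<phi> L * (-1) ^ card T * (\<Prod>b\<in>L \<union> T. x b))" .
  qed
  also have "\<dots> = (\<Sum>(L, T)\<in>(SIGMA L:Pow B. Pow (B - L)). \<phi> L * (-1) ^ card T * (\<Prod>b\<in>L \<union> T. x b))"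
    using assms by (intro sum.Sigma) (auto intro: finite_subset)
  finally show ?thesis .
qed

text \<open>At 0/1 values only the summand with \<open>L\<close> equal to the set of ones survives,
  so every function of a set of positions is such a polynomial.\<close>

lemma multilinear_indicator:
  fixes \<phi> :: "'a set \<Rightarrow> real"
  assumes "finite B"
  shows "(\<Sum>L\<in>Pow B. \<phi> L * ((\<Prod>b\<in>L. of_bool (X b)) * (\<Prod>b\<in>B - L. 1 - of_bool (X b)))) = \<phi> {b \<in> B. X b}"
proof -
  have "(\<Prod>b\<in>L. of_bool (X b)) * (\<Prod>b\<in>B - L. 1 - of_bool (X b)) = (if L = {b \<in> B. X b} then 1 else 0 :: real)"
    if "L \<in> Pow B" for L
  proof (cases "L = {b \<in> B. X b}")
    case True
    then have "(\<Prod>b\<in>L. of_bool (X b)) = (1::real)" "(\<Prod>b\<in>B - L. 1 - of_bool (X b)) = (1::real)"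
      by (auto intro!: prod.neutral)
    then show ?thesis using True by simp
  next
    case False
    have fin: "finite L" "finite (B - L)" using that assms finite_subset by auto
    from False that consider b where "b \<in> L" "\<not> X b" | b where "b \<in> B - L" "X b" by auto
    then have "(\<Prod>b\<in>L. of_bool (X b)) = (0::real) \<or> (\<Prod>b\<in>B - L. 1 - of_bool (X b)) = (0::real)"
      using fin by cases (auto simp: prod_zero_iff)
    then show ?thesis using False by auto
  qed
  then have "(\<Sum>L\<in>Pow B. \<phi> L * ((\<Prod>b\<in>L. of_bool (X b)) * (\<Prod>b\<in>B - L. 1 - of_bool (X b))))
      = (\<Sum>L\<in>Pow B. if L = {b \<in> B. X b} then \<phi> L else 0)"
    by (intro sum.cong refl) auto
  also have "\<dots> = \<phi> {b \<in> B. X b}" using assms by (subst sum.delta) auto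
  finally show ?thesis .
qed

text \<open>Tannery's theorem concerns a single sequence. Uniformity over \<open>x\<close> follows
  by applying it to a worst case: for each \<open>M\<close> a parameter that violates the conclusion
  is chosen, if there is one.\<close>

lemma uniform_tannery:
  fixes t :: "nat \<Rightarrow> 'x \<Rightarrow> nat \<Rightarrow> real"
  assumes lim: "\<And>r \<epsilon>. 0 < \<epsilon> \<Longrightarrow> \<forall>\<^sub>F M in sequentially. \<forall>x. ok M x \<longrightarrow> \<bar>t M x r - L r\<bar> < \<epsilon>"
    and bnd: "\<forall>\<^sub>F M in sequentially. \<forall>x r. ok M x \<longrightarrow> \<bar>t M x r\<bar> \<le> B r"
    and L: "\<And>r. \<bar>L r\<bar> \<le> B r" and B: "summable B" and \<epsilon>: "0 < \<epsilon>"
  shows "\<forall>\<^sub>F M in sequentially. \<forall>x. ok M x \<longrightarrow> \<bar>(\<Sum>r. t M x r) - (\<Sum>r. L r)\<bar> < \<epsilon>"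
proof -
  define viol where "viol M x \<longleftrightarrow> ok M x \<and> \<not> \<bar>(\<Sum>r. t M x r) - (\<Sum>r. L r)\<bar> < \<epsilon>" for M x
  \<comment> \<open>Without a violating parameter the limit itself is inserted, so the hypotheses
    hold trivially for that \<open>M\<close>.\<close>
  define s where "s r M = (if \<exists>x. viol M x then t M (SOME x. viol M x) r else L r)" for r M
  have ok: "ok M (SOME x. viol M x)" if "\<exists>x. viol M x" for M
    using someI_ex[OF that] by (simp add: viol_def)
  have "s r \<longlonglongrightarrow> L r" for r
  proof (rule tendstoI)
    fix e :: real assume "0 < e"
    from lim[OF this] show "\<forall>\<^sub>F M in sequentially. dist (s r M) (L r) < e"
      by eventually_elim (use ok \<open>0 < e\<close> in \<open>auto simp: s_def dist_real_def\<close>)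
  qed
  moreover have "\<forall>\<^sub>F M in sequentially. \<forall>r. norm (s r M) \<le> B r"
    using bnd by eventually_elim (use ok L in \<open>auto simp: s_def\<close>)
  then have "\<forall>\<^sub>F (r, M) in at_top \<times>\<^sub>F sequentially. norm (s r M) \<le> B r"
    unfolding eventually_prod_filter
    by (intro exI[of _ "\<lambda>_. True"] exI[of _ "\<lambda>M. \<forall>r. norm (s r M) \<le> B r"]) auto
  ultimately have "(\<lambda>M. \<Sum>r. s r M) \<longlonglongrightarrow> (\<Sum>r. L r)"
    using tannerys_theorem[of s L sequentially B] B by auto
  from tendstoD[OF this \<epsilon>] show ?thesis
  proof eventually_elim
    case (elim M)
    show ?case
    proof (rule ccontr)
      assume "\<not> ?case"
      then have ex: "\<exists>x. viol M x" by (auto simp: viol_def)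
      then have "viol M (SOME x. viol M x)" by (rule someI_ex)
      then have "\<not> \<bar>(\<Sum>r. t M (SOME x. viol M x) r) - (\<Sum>r. L r)\<bar> < \<epsilon>" unfolding viol_def by blast
      with ex elim show False by (simp add: s_def dist_real_def)
    qed
  qed
qed

lemma of_bool_Ball_eq_prod:
  "finite A \<Longrightarrow> of_bool (\<forall>x\<in>A. P x) = (\<Prod>x\<in>A. of_bool (P x) :: real)"
  by (induction A rule: finite_induct) (auto simp: of_bool_def)

section \<open>Planted configurations and the two claims of the induction\<close>

context csa
begin

definition nusers :: "nat \<Rightarrow> nat" where
  "nusers M = nat \<lfloor>\<alpha> * real M\<rfloor>"

definition user_edges :: "nat set \<Rightarrow> config \<Rightarrow> (nat \<times> nat) set" where
  "user_edges P c = {(u, j). u \<in> P \<and> (\<exists>h xs. c u = Some (h, xs) \<and> j < n h)}"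

lemma edges_eq: "edges n N c = user_edges {..<N} c"
  by (simp add: edges_def user_edges_def)

text \<open>Alone among the planted edges only; users outside \<open>P\<close> may still send into
  the same slice, and these are the random ones.\<close>

definition lone :: "nat set \<Rightarrow> config \<Rightarrow> nat \<times> nat \<Rightarrow> bool" where
  "lone P c e \<longleftrightarrow> e \<in> user_edges P c \<and> (\<forall>e'\<in>user_edges P c. slice_of c e' = slice_of c e \<longrightarrow> e' = e)"

text \<open>Shifted so that level \<open>0\<close> (every segment is still unknown) precedes the first user-to-slice message.\<close>

definition unresolved :: "nat \<Rightarrow> config \<Rightarrow> nat \<Rightarrow> nat \<times> nat \<Rightarrow> bool" where
  "unresolved N c l e = (case l of 0 \<Rightarrow> True | Suc i \<Rightarrow> unres G k n N c i e)"

abbreviation collision :: "nat \<Rightarrow> config \<Rightarrow> nat \<Rightarrow> nat \<times> nat \<Rightarrow> bool" where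
  "collision N c l e \<equiv> coll G k n N c l e"

text \<open>The purpose of the shifted levels: the initial and the recursive clause of
  \<open>coll\<close> become one rule.\<close>

lemma collision_iff:
  "collision N c l e \<longleftrightarrow>
   (\<exists>e'\<in>user_edges {..<N} c. e' \<noteq> e \<and> slice_of c e' = slice_of c e \<and> unresolved N c l e')"
  by (cases l) (auto simp: unresolved_def edges_eq)

definition planted :: "nat \<Rightarrow> nat set \<Rightarrow> config \<Rightarrow> bool" where
  "planted M P c \<longleftrightarrow> P \<subseteq> {..<nusers M} \<and> (\<forall>u\<in>P. valid (M * k) (c u))"

definition rest :: "nat \<Rightarrow> nat set \<Rightarrow> config pmf" where
  "rest M P = Pi_pmf ({..<nusers M} - P) None (\<lambda>_. user (M * k))"

text \<open>Here \<open>a\<close> stands for the limit of 1 - p_l. The power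
  \<open>a ^ card E\<close> expresses asymptotic independence of the edges in \<open>E\<close>. The
  planted configuration \<open>c0\<close> is arbitrary and not random, so the statement can later be
  averaged over it.\<close>

definition slice_claim :: "nat \<Rightarrow> real \<Rightarrow> bool" where
  "slice_claim l a \<longleftrightarrow> (\<forall>r. \<forall>\<epsilon>>0. \<forall>\<^sub>F M in sequentially. \<forall>P c0 E.
     planted M P c0 \<and> card P \<le> r \<and> (\<forall>e\<in>E. lone P c0 e) \<longrightarrow>
     \<bar>expect (rest M P) (\<lambda>c. of_bool (\<forall>e\<in>E. \<not> collision (nusers M) (override_on c c0 P) l e)) - a ^ card E\<bar> < \<epsilon>)"

text \<open>The edge \<open>jj u\<close> itself may share its slice: it is the one that carries the
  outgoing message, which depends only on the other edges of the user. Only those others have to be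
  alone.\<close>

definition isolated_user :: "nat set \<Rightarrow> config \<Rightarrow> (nat \<Rightarrow> nat) \<Rightarrow> nat \<Rightarrow> bool" where
  "isolated_user P c jj u \<longleftrightarrow> (u, jj u) \<in> user_edges P c \<and>
     (\<forall>j. j \<noteq> jj u \<longrightarrow> (u, j) \<in> user_edges P c \<longrightarrow> lone P c (u, j))"

definition user_claim :: "nat \<Rightarrow> (nat \<Rightarrow> nat \<Rightarrow> real) \<Rightarrow> bool" where
  "user_claim l f \<longleftrightarrow> (\<forall>r. \<forall>\<epsilon>>0. \<forall>\<^sub>F M in sequentially. \<forall>P c0 V jj.
     planted M P c0 \<and> card P \<le> r \<and> V \<subseteq> P \<and> (\<forall>u\<in>V. isolated_user P c0 jj u) \<longrightarrow>
     \<bar>expect (rest M P) (\<lambda>c. of_bool (\<forall>u\<in>V. unresolved (nusers M) (override_on c c0 P) l (u, jj u)))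
       - (\<Prod>u\<in>V. f (code_of c0 u) (jj u))\<bar> < \<epsilon>)"

lemma eventually_slices: "\<forall>\<^sub>F M in sequentially. b \<le> M * k"
  unfolding eventually_sequentially using k_pos
  by (intro exI[of _ b]) (metis le_trans mult.right_neutral mult_le_mono)

lemma finite_set_rest: "D \<le> M * k \<Longrightarrow> finite (set_pmf (rest M P))"
  unfolding rest_def by (intro finite_set_Pi_pmf finite_set_user) auto

text \<open>At the shifted level 0 every segment is unknown, so probability and product are both
  1.\<close>

lemma user_claim_0: "user_claim 0 (\<lambda>_ _. 1)"
  unfolding user_claim_def unresolved_def by simp

lemma slice_of_override: "slice_of (override_on c c0 P) (u, j) = (if u \<in> P then slice_of c0 (u, j) else slice_of c (u, j))"
  by (simp add: slice_of_def override_on_def)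

text \<open>The joint failure indicator is a polynomial in the non-collision indicators of the other
  edges of \<open>V\<close>, all of which are lone. \<open>slice_claim\<close> replaces each
  expected monomial by a power of \<open>a\<close>, and the resulting polynomial factors into the
  erasure probabilities.\<close>

lemma user_claim_Suc:
  assumes claim: "slice_claim l a" and a: "0 \<le> a" "a \<le> 1"
  shows "user_claim (Suc l) (\<lambda>h. erasure_prob (G h) k (n h) a)"
  unfolding user_claim_def
proof (intro allI impI)
  fix r :: nat and \<epsilon> :: real assume \<epsilon>: "0 < \<epsilon>"
  \<comment> \<open>Bound for the number of monomials: at most \<open>4 ^ D\<close> pairs of subsets
    for each of at most \<open>r\<close> users.\<close>
  define C where "C = (4::real) ^ (D * r)"
  have C: "C > 0" by (simp add: C_def)
  define \<delta> where "\<delta> = \<epsilon> / (2 * C)"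
  have \<delta>: "0 < \<delta>" using \<epsilon> C by (simp add: \<delta>_def)
  have "\<forall>\<^sub>F M in sequentially. \<forall>P c0 E.
     planted M P c0 \<and> card P \<le> r \<and> (\<forall>e\<in>E. lone P c0 e) \<longrightarrow>
     \<bar>expect (rest M P) (\<lambda>c. of_bool (\<forall>e\<in>E. \<not> collision (nusers M) (override_on c c0 P) l e)) - a ^ card E\<bar> < \<delta>"
    using claim \<delta> unfolding slice_claim_def by blast
  then show "\<forall>\<^sub>F M in sequentially. \<forall>P c0 V jj.
     planted M P c0 \<and> card P \<le> r \<and> V \<subseteq> P \<and> (\<forall>u\<in>V. isolated_user P c0 jj u) \<longrightarrow>
     \<bar>expect (rest M P) (\<lambda>c. of_bool (\<forall>u\<in>V. unresolved (nusers M) (override_on c c0 P) (Suc l) (u, jj u)))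
       - (\<Prod>u\<in>V. erasure_prob (G (code_of c0 u)) k (n (code_of c0 u)) a (jj u))\<bar> < \<epsilon>"
    using eventually_slices[of D]
  proof (eventually_elim, intro allI impI)
    fix M P c0 V jj
    assume H: "\<forall>P c0 E. planted M P c0 \<and> card P \<le> r \<and> (\<forall>e\<in>E. lone P c0 e) \<longrightarrow>
     \<bar>expect (rest M P) (\<lambda>c. of_bool (\<forall>e\<in>E. \<not> collision (nusers M) (override_on c c0 P) l e)) - a ^ card E\<bar> < \<delta>"
      and DS: "D \<le> M * k"
      and A: "planted M P c0 \<and> card P \<le> r \<and> V \<subseteq> P \<and> (\<forall>u\<in>V. isolated_user P c0 jj u)"
    have finP: "finite P" using A by (auto simp: planted_def intro: finite_subset)
    have finV: "finite V" using A finP finite_subset by blast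
    have cV: "card V \<le> r" using A card_mono[OF finP, of V] by simp
    define h where "h u = code_of c0 u" for u
    define Q where "Q u = {..<n (h u)} - {jj u}" for u
    define \<phi> where "\<phi> u K = (of_bool (\<not> map_recovers (G (h u)) k K (jj u)) :: real)" for u K
    define I where "I u = (SIGMA L:Pow (Q u). Pow (Q u - L))" for u
    define w where "w u LT = \<phi> u (fst LT) * (-1) ^ card (snd LT)" for u and LT :: "nat set \<times> nat set"
    \<comment> \<open>A choice function \<open>g\<close> picks one monomial per user;
      \<open>EE g\<close> collects the edges whose indicators occur in the product.\<close>
    define EE where "EE g = (SIGMA u:V. fst (g u) \<union> snd (g u))" for g :: "nat \<Rightarrow> nat set \<times> nat set"
    have edge: "j < n (h u) \<and> h u < \<theta> \<and> (u, j') \<in> user_edges P c0" if "u \<in> V" "j = jj u" "j' < n (h u)" for u j j'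
      using A that unfolding isolated_user_def user_edges_def h_def code_of_def planted_def valid_def by force
    have jj: "jj u < n (h u)" "h u < \<theta>" if "u \<in> V" for u
      using A that unfolding isolated_user_def user_edges_def h_def code_of_def planted_def valid_def by force+
    have finQ: "finite (Q u)" for u by (simp add: Q_def)
    have finI: "finite (I u)" for u using finQ by (auto simp: I_def intro: finite_subset)
    have cI: "real (card (I u)) \<le> 4 ^ D" if "u \<in> V" for u
    proof -
      have "card (I u) \<le> card (Pow (Q u) \<times> Pow (Q u))"
        using finQ by (intro card_mono) (auto simp: I_def)
      also have "\<dots> = 2 ^ card (Q u) * 2 ^ card (Q u)" by (simp add: card_cartesian_product card_Pow finQ)
      also have "\<dots> = 4 ^ card (Q u)" by (simp flip: power_mult_distrib)
      also have "\<dots> \<le> 4 ^ D" using jj[OF that] n_le_D[of "h u"] by (intro power_increasing) (auto simp: Q_def)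
      finally show ?thesis by (simp flip: of_nat_le_iff)
    qed
    have sub: "fst (g u) \<union> snd (g u) \<subseteq> Q u" if "g \<in> PiE V I" "u \<in> V" for g u
      using PiE_mem[OF that] by (auto simp: I_def)
    then have fin_sub: "finite (fst (g u) \<union> snd (g u))" if "g \<in> PiE V I" "u \<in> V" for g u
      using that finQ finite_subset by blast
    have prod_EE: "(\<Prod>u\<in>V. \<Prod>b\<in>fst (g u) \<union> snd (g u). x u b) = (\<Prod>(u, b)\<in>EE g. x u b)"
      if "g \<in> PiE V I" for g and x :: "nat \<Rightarrow> nat \<Rightarrow> real"
      unfolding EE_def using finV fin_sub[OF that] by (intro prod.Sigma) auto
    have finEE: "finite (EE g)" if "g \<in> PiE V I" for g
      unfolding EE_def using finV fin_sub[OF that] by (intro finite_SigmaI)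
    have expand: "(\<Prod>u\<in>V. \<Sum>L\<in>Pow (Q u). \<phi> u L * ((\<Prod>b\<in>L. x u b) * (\<Prod>b\<in>Q u - L. 1 - x u b)))
        = (\<Sum>g\<in>PiE V I. (\<Prod>u\<in>V. w u (g u)) * (\<Prod>(u, b)\<in>EE g. x u b))" for x :: "nat \<Rightarrow> nat \<Rightarrow> real"
    proof -
      have "(\<Prod>u\<in>V. \<Sum>L\<in>Pow (Q u). \<phi> u L * ((\<Prod>b\<in>L. x u b) * (\<Prod>b\<in>Q u - L. 1 - x u b)))
         = (\<Prod>u\<in>V. \<Sum>LT\<in>I u. w u LT * (\<Prod>b\<in>fst LT \<union> snd LT. x u b))"
        by (intro prod.cong refl) (simp add: multilinear_expand[OF finQ] I_def w_def case_prod_unfold)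
      also have "\<dots> = (\<Sum>g\<in>PiE V I. \<Prod>u\<in>V. w u (g u) * (\<Prod>b\<in>fst (g u) \<union> snd (g u). x u b))"
        using finV finI by (intro prod_sum_PiE)
      also have "\<dots> = (\<Sum>g\<in>PiE V I. (\<Prod>u\<in>V. w u (g u)) * (\<Prod>(u, b)\<in>EE g. x u b))"
        by (intro sum.cong refl) (simp add: prod.distrib prod_EE)
      finally show ?thesis .
    qed
    have ind: "of_bool (\<forall>u\<in>V. unresolved (nusers M) (override_on c c0 P) (Suc l) (u, jj u))
        = (\<Sum>g\<in>PiE V I. (\<Prod>u\<in>V. w u (g u)) * of_bool (\<forall>e\<in>EE g. \<not> collision (nusers M) (override_on c c0 P) l e))" for c
    proof -
      let ?c = "override_on c c0 P"
      let ?X = "\<lambda>u j. \<not> collision (nusers M) ?c l (u, j)"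
      have "unresolved (nusers M) ?c (Suc l) (u, jj u) \<longleftrightarrow> \<not> map_recovers (G (h u)) k {j \<in> Q u. ?X u j} (jj u)" if "u \<in> V" for u
      proof -
        have "code_of ?c u = h u" using A that by (auto simp: code_of_def h_def)
        moreover have "{j \<in> Q u. ?X u j} = {j'. j' < n (h u) \<and> j' \<noteq> jj u \<and> ?X u j'}" by (auto simp: Q_def)
        ultimately show ?thesis by (simp add: unresolved_def Let_def)
      qed
      then have "of_bool (\<forall>u\<in>V. unresolved (nusers M) ?c (Suc l) (u, jj u)) = (\<Prod>u\<in>V. \<phi> u {j \<in> Q u. ?X u j})"
        unfolding of_bool_Ball_eq_prod[OF finV] \<phi>_def by (intro prod.cong refl) simp
      also have "\<dots> = (\<Prod>u\<in>V. \<Sum>L\<in>Pow (Q u). \<phi> u L * ((\<Prod>b\<in>L. of_bool (?X u b)) * (\<Prod>b\<in>Q u - L. 1 - of_bool (?X u b))))"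
        by (intro prod.cong refl) (simp only: multilinear_indicator[OF finQ])
      also have "\<dots> = (\<Sum>g\<in>PiE V I. (\<Prod>u\<in>V. w u (g u)) * (\<Prod>(u, b)\<in>EE g. of_bool (?X u b)))"
        by (rule expand)
      also have "\<dots> = (\<Sum>g\<in>PiE V I. (\<Prod>u\<in>V. w u (g u)) * of_bool (\<forall>e\<in>EE g. \<not> collision (nusers M) ?c l e))"
        by (intro sum.cong refl arg_cong2[where f = "(*)"])
           (simp only: of_bool_Ball_eq_prod[OF finEE] case_prod_unfold prod.collapse)
      finally show ?thesis .
    qed
    have lim: "(\<Prod>u\<in>V. erasure_prob (G (code_of c0 u)) k (n (code_of c0 u)) a (jj u))
        = (\<Sum>g\<in>PiE V I. (\<Prod>u\<in>V. w u (g u)) * a ^ card (EE g))"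
    proof -
      have "erasure_prob (G (code_of c0 u)) k (n (code_of c0 u)) a (jj u)
          = (\<Sum>L\<in>Pow (Q u). \<phi> u L * ((\<Prod>b\<in>L. a) * (\<Prod>b\<in>Q u - L. 1 - a)))" if "u \<in> V" for u
        unfolding erasure_prob_def \<phi>_def h_def[symmetric] Q_def[symmetric]
      proof (intro sum.cong refl)
        fix L assume "L \<in> Pow (Q u)"
        then have "card (Q u - L) = n (h u) - 1 - card L"
          using jj[OF that] finQ by (subst card_Diff_subset) (auto simp: Q_def intro: finite_subset)
        then show "a ^ card L * (1 - a) ^ (n (h u) - 1 - card L) * of_bool (\<not> map_recovers (G (h u)) k L (jj u))
           = of_bool (\<not> map_recovers (G (h u)) k L (jj u)) * ((\<Prod>b\<in>L. a) * (\<Prod>b\<in>Q u - L. 1 - a))"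
          by simp
      qed
      then show ?thesis using expand[of "\<lambda>_ _. a"] by (simp add: case_prod_unfold cong: prod.cong)
    qed
    have wle: "\<bar>\<Prod>u\<in>V. w u (g u)\<bar> \<le> 1" for g
      unfolding abs_prod by (intro prod_le_1) (auto simp: w_def \<phi>_def abs_mult)
    have close: "\<bar>expect (rest M P) (\<lambda>c. of_bool (\<forall>e\<in>EE g. \<not> collision (nusers M) (override_on c c0 P) l e)) - a ^ card (EE g)\<bar> \<le> \<delta>"
      if "g \<in> PiE V I" for g
    proof -
      have "\<forall>e\<in>EE g. lone P c0 e"
      proof
        fix e assume "e \<in> EE g"
        then obtain u j where e: "e = (u, j)" "u \<in> V" "j \<in> Q u"
          using sub[OF \<open>g \<in> PiE V I\<close>] unfolding EE_def by blast
        then have "(u, j) \<in> user_edges P c0" using edge[OF e(2) refl, of j] by (simp add: Q_def)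
        then show "lone P c0 e" using A e unfolding isolated_user_def Q_def by blast
      qed
      with H A show ?thesis by (intro less_imp_le) blast
    qed
    \<comment> \<open>One polynomial, with expected monomials on one side and powers of
      \<open>a\<close> on the other. Its coefficients have absolute value at most 1.\<close>
    have "\<bar>expect (rest M P) (\<lambda>c. of_bool (\<forall>u\<in>V. unresolved (nusers M) (override_on c c0 P) (Suc l) (u, jj u)))
       - (\<Prod>u\<in>V. erasure_prob (G (code_of c0 u)) k (n (code_of c0 u)) a (jj u))\<bar>
      = \<bar>\<Sum>g\<in>PiE V I. (\<Prod>u\<in>V. w u (g u)) *
          (expect (rest M P) (\<lambda>c. of_bool (\<forall>e\<in>EE g. \<not> collision (nusers M) (override_on c c0 P) l e)) - a ^ card (EE g))\<bar>"
      unfolding ind lim expect_sum[OF finite_set_rest[OF DS]]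
      by (simp only: integral_mult_right_zero sum_subtractf right_diff_distrib)
    also have "\<dots> \<le> (\<Sum>g\<in>PiE V I. 1 * \<delta>)"
      unfolding abs_mult by (intro order_trans[OF sum_abs] sum_mono) (simp only: abs_mult, intro mult_mono wle close, auto)
    also have "\<dots> = real (card (PiE V I)) * \<delta>" by simp
    also have "\<dots> \<le> C * \<delta>"
    proof (rule mult_right_mono)
      have "real (card (PiE V I)) = (\<Prod>u\<in>V. real (card (I u)))" using finV by (simp add: card_PiE)
      also have "\<dots> \<le> (\<Prod>u\<in>V. 4 ^ D)" using cI by (intro prod_mono) auto
      also have "\<dots> = 4 ^ (D * card V)" by (simp add: power_mult)
      also have "\<dots> \<le> C" unfolding C_def using cV by (intro power_increasing) auto
      finally show "real (card (PiE V I)) \<le> C" .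
    qed (use \<delta> in simp)
    also have "\<dots> < \<epsilon>" using C \<epsilon> by (simp add: \<delta>_def)
    finally show "\<bar>expect (rest M P) (\<lambda>c. of_bool (\<forall>u\<in>V. unresolved (nusers M) (override_on c c0 P) (Suc l) (u, jj u)))
       - (\<Prod>u\<in>V. erasure_prob (G (code_of c0 u)) k (n (code_of c0 u)) a (jj u))\<bar> < \<epsilon>" .
  qed
qed

end

section \<open>Users that reach given slices\<close>

context csa
begin

definition occupied :: "(nat \<times> nat list) option \<Rightarrow> nat set" where
  "occupied v = (case v of None \<Rightarrow> {} | Some (h, xs) \<Rightarrow> set xs)"

lemma occupied_valid:
  assumes "valid S v"
  shows "occupied v \<subseteq> {..<S}" "finite (occupied v)" "card (occupied v) \<le> D"
proof -
  have "card (occupied v) \<le> D"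
  proof (cases v)
    case (Some w)
    obtain h xs where v: "v = Some (h, xs)" using Some by (cases w) auto
    then have h: "h < \<theta>" and xs: "length xs = n h" using assms by (auto simp: valid_def placements_def)
    have "card (set xs) \<le> n h" using card_length[of xs] xs by simp
    then show ?thesis using n_le_D[OF h] by (simp add: occupied_def v)
  qed (simp add: occupied_def)
  then show "occupied v \<subseteq> {..<S}" "finite (occupied v)" "card (occupied v) \<le> D"
    using assms by (auto simp: occupied_def valid_def placements_def split: option.splits)
qed

text \<open>In the applications \<open>u\<close> lies outside the originally planted set and
  \<open>T\<close> consists of the slices of the edges in \<open>E\<close>: such a user causes a
  collision on one of these edges.\<close>

definition bad :: "nat \<Rightarrow> nat \<Rightarrow> nat set \<Rightarrow> config \<Rightarrow> nat \<Rightarrow> bool" where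
  "bad N l T c u \<longleftrightarrow> (\<exists>j. (u, j) \<in> user_edges {u} c \<and> slice_of c (u, j) \<in> T \<and> unresolved N c l (u, j))"

lemma bad_hits: "bad N l T c u \<Longrightarrow> hits T (c u)"
  by (auto simp: bad_def hits_def user_edges_def slice_of_def)

text \<open>Translates an event about edges into one about users. The same user may disturb several
  edges of \<open>E\<close>, so expanding over users avoids double counting.\<close>

lemma no_collision_iff:
  assumes P: "P \<subseteq> {..<N}" and lone: "\<forall>e\<in>E. lone P c0 e"
  shows "(\<forall>e\<in>E. \<not> collision N (override_on c c0 P) l e) \<longleftrightarrow>
         (\<forall>u\<in>{..<N} - P. \<not> bad N l (slice_of c0 ` E) (override_on c c0 P) u)"
proof -
  let ?c = "override_on c c0 P"
  have sl: "slice_of ?c e = slice_of c0 e \<and> fst e \<in> P" if "e \<in> E" for e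
    using lone that by (cases e) (auto simp: lone_def user_edges_def slice_of_override)
  have "\<exists>e\<in>E. collision N ?c l e" if "u \<in> {..<N} - P" "bad N l (slice_of c0 ` E) ?c u" for u
  proof -
    from that(2) obtain j e where j: "(u, j) \<in> user_edges {u} ?c" "unresolved N ?c l (u, j)"
      "e \<in> E" "slice_of ?c (u, j) = slice_of c0 e"
      by (auto simp: bad_def)
    have "(u, j) \<in> user_edges {..<N} ?c" "(u, j) \<noteq> e" "slice_of ?c (u, j) = slice_of ?c e"
      using j sl[OF j(3)] that(1) by (auto simp: user_edges_def)
    then have "collision N ?c l e" unfolding collision_iff using j by blast
    with j show ?thesis by blast
  qed
  moreover have "\<exists>u\<in>{..<N} - P. bad N l (slice_of c0 ` E) ?c u" if e: "e \<in> E" "collision N ?c l e" for e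
  proof -
    from e obtain u j where j: "(u, j) \<in> user_edges {..<N} ?c" "(u, j) \<noteq> e"
        "slice_of ?c (u, j) = slice_of ?c e" "unresolved N ?c l (u, j)"
      unfolding collision_iff by auto
    \<comment> \<open>A planted user cannot be the culprit, since \<open>e\<close> is alone among
      the planted edges.\<close>
    have "u \<notin> P"
    proof
      assume u: "u \<in> P"
      then have "(u, j) \<in> user_edges P c0" "slice_of c0 (u, j) = slice_of c0 e"
        using j sl[OF e(1)] by (auto simp: user_edges_def slice_of_override)
      then show False using lone e(1) j(2) by (auto simp: lone_def)
    qed
    moreover have "bad N l (slice_of c0 ` E) ?c u"
      unfolding bad_def using j sl[OF e(1)] e(1) by (auto simp: user_edges_def)
    ultimately show ?thesis using j(1) by (auto simp: user_edges_def)
  qed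
  ultimately show ?thesis by blast
qed

definition bad_prob :: "nat \<Rightarrow> nat \<Rightarrow> nat set \<Rightarrow> config \<Rightarrow> nat set \<Rightarrow> nat set \<Rightarrow> real" where
  "bad_prob M l P c0 T V =
     expect (rest M P) (\<lambda>c. of_bool (\<forall>u\<in>V. bad (nusers M) l T (override_on c c0 P) u))"

text \<open>The same probability after the users of \<open>V\<close> have been revealed as
  \<open>x\<close>; they have become planted, so that the induction hypothesis can be applied to
  \<open>P \<union> V\<close>.\<close>

definition cond_bad_prob :: "nat \<Rightarrow> nat \<Rightarrow> nat set \<Rightarrow> config \<Rightarrow> nat set \<Rightarrow> nat set \<Rightarrow> config \<Rightarrow> real" where
  "cond_bad_prob M l P c0 T V x =
     expect (rest M (P \<union> V)) (\<lambda>c. of_bool (\<forall>u\<in>V. bad (nusers M) l T (override_on c (override_on c0 x V) (P \<union> V)) u))"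

lemma inclusion_exclusion:
  assumes "D \<le> M * k" "P \<subseteq> {..<nusers M}" "\<forall>e\<in>E. lone P c0 e"
  shows "expect (rest M P) (\<lambda>c. of_bool (\<forall>e\<in>E. \<not> collision (nusers M) (override_on c c0 P) l e))
       = (\<Sum>V\<in>Pow ({..<nusers M} - P). (-1) ^ card V * bad_prob M l P c0 (slice_of c0 ` E) V)"
proof -
  let ?R = "{..<nusers M} - P" and ?T = "slice_of c0 ` E"
  have "(of_bool (\<forall>e\<in>E. \<not> collision (nusers M) c l e) :: real)
      = (\<Sum>V\<in>Pow ?R. (-1) ^ card V * of_bool (\<forall>u\<in>V. bad (nusers M) l ?T c u))"
    if "c = override_on c' c0 P" for c c'
  proof -
    have "of_bool (\<forall>e\<in>E. \<not> collision (nusers M) c l e) = (\<Prod>u\<in>?R. 1 - of_bool (bad (nusers M) l ?T c u) :: real)"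
      unfolding that no_collision_iff[OF assms(2,3)]
      by (subst of_bool_Ball_eq_prod) (auto simp: of_bool_def intro!: prod.cong)
    also have "\<dots> = (\<Sum>V\<in>Pow ?R. (-1) ^ card V * of_bool (\<forall>u\<in>V. bad (nusers M) l ?T c u))"
      by (subst prod_diff_conv_sum) (auto intro!: sum.cong simp: of_bool_Ball_eq_prod finite_subset)
    finally show ?thesis .
  qed
  then show ?thesis
    unfolding bad_prob_def
    by (simp only: expect_sum[OF finite_set_rest[OF assms(1)]] integral_mult_right_zero)
qed

text \<open>The users are independent, so those of \<open>V\<close> may be drawn first.\<close>

lemma bad_prob_conv_cond:
  assumes "D \<le> M * k" "V \<subseteq> {..<nusers M} - P"
  shows "bad_prob M l P c0 T V = expect (Pi_pmf V None (\<lambda>_. user (M * k))) (cond_bad_prob M l P c0 T V)"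
proof -
  have split: "{..<nusers M} - P = V \<union> ({..<nusers M} - (P \<union> V))" using assms(2) by auto
  have ov: "override_on (override_on c x V) c0 P = override_on c (override_on c0 x V) (P \<union> V)" for c x
    using assms(2) by (auto simp: override_on_def fun_eq_iff)
  have "finite V" using assms(2) finite_subset by blast
  then show ?thesis
    unfolding bad_prob_def cond_bad_prob_def rest_def
    by (subst split, subst expect_Pi_pmf_union) (auto simp: finite_set_user assms(1) ov)
qed

lemma cond_bad_prob_le:
  assumes "finite V"
  shows "cond_bad_prob M l P c0 T V x \<le> (\<Prod>u\<in>V. of_bool (hits T (x u)))"
proof (cases "\<forall>u\<in>V. hits T (x u)")
  case True
  then have "(\<Prod>u\<in>V. of_bool (hits T (x u))) = (1::real)" by simp
  then show ?thesis unfolding cond_bad_prob_def by (simp only: expect_of_bool_bounds)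
next
  case False
  have "(\<forall>u\<in>V. bad (nusers M) l T (override_on c (override_on c0 x V) (P \<union> V)) u) = False" for c
  proof -
    obtain u where u: "u \<in> V" "\<not> hits T (x u)" using False by blast
    then have "\<not> hits T (override_on c (override_on c0 x V) (P \<union> V) u)" by simp
    then show ?thesis using bad_hits u by blast
  qed
  then have "cond_bad_prob M l P c0 T V x = 0" unfolding cond_bad_prob_def by (simp only: of_bool_eq) simp
  then show ?thesis by (simp add: prod_nonneg)
qed

lemma expect_prod_hits_le:
  assumes "D \<le> S" "T \<subseteq> {..<S}" "finite V"
  shows "expect (Pi_pmf V None (\<lambda>_. user S)) (\<lambda>x. \<Prod>u\<in>V. of_bool (hits T (x u))) \<le> (real D * real (card T) / real S) ^ card V"
proof -
  have "expect (Pi_pmf V None (\<lambda>_. user S)) (\<lambda>x. \<Prod>u\<in>V. of_bool (hits T (x u)))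
      = (\<Prod>u\<in>V. expect (user S) (\<lambda>v. of_bool (hits T v)))"
    using assms by (intro expect_prod_Pi_pmf) (auto simp: finite_set_user)
  also have "\<dots> \<le> (\<Prod>u\<in>V. real D * real (card T) / real S)"
    using expect_hits_le[OF assms(1,2)] by (intro prod_mono) (auto simp: expect_of_bool_bounds)
  finally show ?thesis by simp
qed

lemma bad_prob_nonneg: "0 \<le> bad_prob M l P c0 T V"
  unfolding bad_prob_def by (rule expect_of_bool_bounds)

text \<open>Offending requires hitting \<open>T\<close>, and hits of different users are
  independent. This crude bound holds for every size of \<open>V\<close> and later supplies the
  summable majorant.\<close>

lemma bad_prob_le:
  assumes "D \<le> M * k" "V \<subseteq> {..<nusers M} - P" "T \<subseteq> {..<M * k}"
  shows "bad_prob M l P c0 T V \<le> (real D * real (card T) / real (M * k)) ^ card V"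
proof -
  have fin: "finite V" using assms(2) finite_subset by blast
  have "bad_prob M l P c0 T V \<le> expect (Pi_pmf V None (\<lambda>_. user (M * k))) (\<lambda>x. \<Prod>u\<in>V. of_bool (hits T (x u)))"
    unfolding bad_prob_conv_cond[OF assms(1,2)]
    by (intro expect_mono cond_bad_prob_le finite_set_Pi_pmf finite_set_user assms fin)
  also have "\<dots> \<le> (real D * real (card T) / real (M * k)) ^ card V"
    by (rule expect_prod_hits_le[OF assms(1,3) fin])
  finally show ?thesis .
qed

text \<open>Slices that are not fresh for user \<open>u\<close>. In the applications
  \<open>T\<close> is contained in the first union, so a second segment in \<open>T\<close> also
  counts as a segment in \<open>near\<close>.\<close>

definition near :: "nat set \<Rightarrow> config \<Rightarrow> nat set \<Rightarrow> config \<Rightarrow> nat \<Rightarrow> nat set" where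
  "near P c0 V x u = (\<Union>v\<in>P. occupied (c0 v)) \<union> (\<Union>v\<in>V - {u}. occupied (x v))"

lemma near_subset_card:
  assumes "finite P" "finite V" "\<forall>u\<in>P. valid S (c0 u)" "\<forall>u\<in>V. valid S (x u)"
  shows "near P c0 V x u \<subseteq> {..<S}" "card (near P c0 V x u) \<le> (card P + card V) * D"
proof -
  show "near P c0 V x u \<subseteq> {..<S}"
    using assms occupied_valid(1) unfolding near_def by blast
  have "card (near P c0 V x u) \<le> card (\<Union>v\<in>P. occupied (c0 v)) + card (\<Union>v\<in>V - {u}. occupied (x v))"
    unfolding near_def by (rule card_Un_le)
  also have "\<dots> \<le> (\<Sum>v\<in>P. card (occupied (c0 v))) + (\<Sum>v\<in>V - {u}. card (occupied (x v)))"
    using assms by (intro add_mono card_UN_le) auto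
  also have "\<dots> \<le> (\<Sum>v\<in>P. D) + (\<Sum>v\<in>V - {u}. D)"
    using assms occupied_valid(3) by (intro add_mono sum_mono) auto
  also have "\<dots> \<le> (card P + card V) * D"
    using card_mono[of V "V - {u}"] assms(2) by (simp add: algebra_simps mult_le_mono2)
  finally show "card (near P c0 V x u) \<le> (card P + card V) * D" .
qed

text \<open>If every user of \<open>V\<close> meets \<open>T\<close> exactly once and its other segments land in fresh slices, the
  hypothesis on planted users applies to \<open>P \<union> V\<close>; otherwise some user of \<open>V\<close> has two
  constrained segments.\<close>

lemma cond_bad_prob_approx:
  assumes DS: "D \<le> M * k" and pl: "planted M P c0" and V: "V \<subseteq> {..<nusers M} - P"
    and T: "T \<subseteq> (\<Union>v\<in>P. occupied (c0 v))" and x: "\<forall>u\<in>V. valid (M * k) (x u)"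
    and f: "\<And>h j. 0 \<le> f h j" and F: "\<And>h j. h < \<theta> \<Longrightarrow> j < n h \<Longrightarrow> f h j \<le> F" "0 \<le> F"
    and \<delta>: "0 \<le> \<delta>"
    and approx: "\<And>jj. \<forall>u\<in>V. isolated_user (P \<union> V) (override_on c0 x V) jj u \<Longrightarrow>
       \<bar>expect (rest M (P \<union> V)) (\<lambda>c. of_bool (\<forall>u\<in>V. unresolved (nusers M) (override_on c (override_on c0 x V) (P \<union> V)) l (u, jj u)))
         - (\<Prod>u\<in>V. f (code_of (override_on c0 x V) u) (jj u))\<bar> \<le> \<delta>"
  shows "\<bar>cond_bad_prob M l P c0 T V x - (\<Prod>u\<in>V. score T f (x u))\<bar>
     \<le> \<delta> * (\<Prod>u\<in>V. of_bool (hits T (x u))) + (1 + (real D * F) ^ card V) *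
        (\<Sum>u\<in>V. of_bool (hits2 T (near P c0 V x u) (x u)) * (\<Prod>v\<in>V - {u}. of_bool (hits T (x v))))"
    (is "_ \<le> \<delta> * ?H + ?C * ?S")
proof -
  have fin: "finite V" using V finite_subset by blast
  have H: "0 \<le> ?H" and S: "0 \<le> ?S" and C: "1 \<le> ?C"
    using F by (auto intro!: prod_nonneg sum_nonneg)
  have W: "0 \<le> cond_bad_prob M l P c0 T V x" "cond_bad_prob M l P c0 T V x \<le> 1"
    unfolding cond_bad_prob_def by (rule expect_of_bool_bounds)+
  have sc: "0 \<le> score T f (x u) \<and> score T f (x u) \<le> real D * F" if u: "u \<in> V" for u
  proof (cases "x u")
    case (Some w)
    obtain h xs where xu: "x u = Some (h, xs)" using Some by (cases w) auto
    then have h: "h < \<theta>" using x u by (auto simp: valid_def)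
    have "(\<Sum>j<n h. of_bool (xs ! j \<in> T) * f h j) \<le> (\<Sum>j<n h. F)"
      using f F h by (intro sum_mono) (auto simp: of_bool_def)
    also have "\<dots> \<le> real D * F" using n_le_D[OF h] F by (simp add: mult_right_mono)
    finally show ?thesis using f by (auto simp: score_def xu intro!: sum_nonneg)
  qed (use F in \<open>simp add: score_def\<close>)
  have P: "0 \<le> (\<Prod>u\<in>V. score T f (x u))" "(\<Prod>u\<in>V. score T f (x u)) \<le> (real D * F) ^ card V"
    using sc prod_mono[of V "\<lambda>u. score T f (x u)" "\<lambda>_. real D * F"] by (auto intro!: prod_nonneg)
  \<comment> \<open>If some user misses \<open>T\<close>, both quantities vanish. If some user has a
    second constrained segment, the trivial bound by \<open>?C\<close> is paid. Only in the last
    case is the hypothesis on planted users applied.\<close>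
  consider (miss) u where "u \<in> V" "\<not> hits T (x u)"
    | (twice) u where "\<forall>v\<in>V. hits T (x v)" "u \<in> V" "hits2 T (near P c0 V x u) (x u)"
    | (good) "\<forall>v\<in>V. hits T (x v)" "\<forall>u\<in>V. \<not> hits2 T (near P c0 V x u) (x u)"
    by blast
  then show ?thesis
  proof cases
    case miss
    have "(\<Prod>u\<in>V. of_bool (hits T (x u))) = (0::real)" using miss fin by (auto simp: prod_zero_iff)
    then have "cond_bad_prob M l P c0 T V x = 0"
      using cond_bad_prob_le[OF fin, of M l P c0 T x] W by simp
    moreover have "score T f (x u) = 0"
      using miss(2) by (auto simp: score_def hits_def split: option.splits intro!: sum.neutral)
    then have "(\<Prod>u\<in>V. score T f (x u)) = 0" using miss fin by (auto simp: prod_zero_iff)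
    ultimately show ?thesis using H S C \<delta> by simp
  next
    case twice
    have "1 \<le> of_bool (hits2 T (near P c0 V x u) (x u)) * (\<Prod>v\<in>V - {u}. of_bool (hits T (x v)) :: real)"
      using twice by simp
    also have "\<dots> \<le> ?S"
      using fin twice(2) by (intro member_le_sum) (auto intro!: prod_nonneg)
    finally have CS: "?C * 1 \<le> ?C * ?S" using C by (intro mult_left_mono) auto
    have "\<bar>cond_bad_prob M l P c0 T V x - (\<Prod>u\<in>V. score T f (x u))\<bar> \<le> ?C * 1"
      using W P by simp
    also note CS
    also have "?C * ?S \<le> \<delta> * ?H + ?C * ?S" using \<delta> H by simp
    finally show ?thesis .
  next
    case good
    let ?c1 = "override_on c0 x V"
    have "\<exists>j h xs. x u = Some (h, xs) \<and> j < n h \<and> xs ! j \<in> T" if "u \<in> V" for u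
      using good(1) that unfolding hits_def by blast
    then obtain jj hh xx where jj: "\<And>u. u \<in> V \<Longrightarrow> x u = Some (hh u, xx u) \<and> jj u < n (hh u) \<and> xx u ! jj u \<in> T"
      by metis
    have xx: "length (xx u) = n (hh u)" "distinct (xx u)" if "u \<in> V" for u
      using x jj[OF that] that by (auto simp: valid_def placements_def)
    have fresh: "xx u ! j \<notin> near P c0 V x u" if "u \<in> V" "j < n (hh u)" "j \<noteq> jj u" for u j
      using good(2) jj[OF that(1)] that unfolding hits2_def by blast
    have notT: "xx u ! j \<notin> T" if "u \<in> V" "j < n (hh u)" "j \<noteq> jj u" for u j
      using fresh[OF that] T unfolding near_def by blast
    have disj: "V \<inter> P = {}" using V by auto
    have iso: "\<forall>u\<in>V. isolated_user (P \<union> V) ?c1 jj u"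
    proof
      fix u assume u: "u \<in> V"
      show "isolated_user (P \<union> V) ?c1 jj u"
        unfolding isolated_user_def
      proof (intro conjI allI impI)
        show "(u, jj u) \<in> user_edges (P \<union> V) ?c1" using jj[OF u] u by (auto simp: user_edges_def)
        fix j assume j: "j \<noteq> jj u" "(u, j) \<in> user_edges (P \<union> V) ?c1"
        then have jn: "j < n (hh u)" using jj[OF u] u by (auto simp: user_edges_def)
        have sl: "slice_of ?c1 (u, j) = xx u ! j" using jj[OF u] u by (simp add: slice_of_def)
        have "e' = (u, j)" if e': "e' \<in> user_edges (P \<union> V) ?c1" "slice_of ?c1 e' = xx u ! j" for e'
        proof -
          obtain v j' where e'v: "e' = (v, j')" by (cases e')
          consider "v = u" | "v \<in> V - {u}" | "v \<in> P" "v \<notin> V"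
            using e' e'v by (auto simp: user_edges_def)
          then show ?thesis
          proof cases
            case 1
            then have "j' < n (hh u)" "xx u ! j' = xx u ! j"
              using e' e'v jj[OF u] u by (auto simp: user_edges_def slice_of_def)
            then show ?thesis using xx[OF u] jn 1 e'v by (simp add: nth_eq_iff_index_eq)
          next
            case 2
            then have "j' < n (hh v)" "xx v ! j' = xx u ! j"
              using e' e'v jj[of v] by (auto simp: user_edges_def slice_of_def)
            then have "xx u ! j \<in> occupied (x v)"
              using 2 jj[of v] xx(1)[of v] by (auto simp: occupied_def in_set_conv_nth)
            then show ?thesis using fresh[OF u jn j(1)] 2 unfolding near_def by blast
          next
            case 3
            then obtain h xs where v: "c0 v = Some (h, xs)" "j' < n h" "xs ! j' = xx u ! j"
              using e' e'v by (auto simp: user_edges_def slice_of_def)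
            moreover have "length xs = n h"
              using pl 3 v(1) by (auto simp: planted_def valid_def placements_def)
            ultimately have "xx u ! j \<in> occupied (c0 v)"
              by (auto simp: occupied_def in_set_conv_nth)
            then show ?thesis using fresh[OF u jn j(1)] 3 unfolding near_def by blast
          qed
        qed
        then show "lone (P \<union> V) ?c1 (u, j)" unfolding lone_def sl using j(2) by blast
      qed
    qed
    \<comment> \<open>Only segment \<open>jj u\<close> lies in \<open>T\<close>, so offending means
      that this segment is unresolved; for the same reason the score reduces to one summand.\<close>
    have "bad (nusers M) l T (override_on c ?c1 (P \<union> V)) u \<longleftrightarrow> unresolved (nusers M) (override_on c ?c1 (P \<union> V)) l (u, jj u)"
      if u: "u \<in> V" for u c
      unfolding bad_def using jj[OF u] notT[OF u] u
      by (auto simp: user_edges_def slice_of_def)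
    then have "cond_bad_prob M l P c0 T V x
       = expect (rest M (P \<union> V)) (\<lambda>c. of_bool (\<forall>u\<in>V. unresolved (nusers M) (override_on c ?c1 (P \<union> V)) l (u, jj u)))"
      unfolding cond_bad_prob_def by (simp cong: ball_cong)
    moreover have "f (code_of ?c1 u) (jj u) = score T f (x u)" if u: "u \<in> V" for u
    proof -
      have "(\<Sum>j<n (hh u). of_bool (xx u ! j \<in> T) * f (hh u) j) = (\<Sum>j<n (hh u). if j = jj u then f (hh u) j else 0)"
        using notT[OF u] jj[OF u] by (intro sum.cong refl) auto
      then show ?thesis using jj[OF u] u by (simp add: score_def code_of_def)
    qed
    then have "(\<Prod>u\<in>V. f (code_of ?c1 u) (jj u)) = (\<Prod>u\<in>V. score T f (x u))" by (intro prod.cong refl)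
    moreover have "?H = 1" using good(1) by simp
    moreover have "0 \<le> ?C * ?S" using C S by simp
    ultimately show ?thesis using approx[OF iso] by simp
  qed
qed

text \<open>Average of the pointwise estimate over the revealed users. The product of scores factors
  by independence; the error consists of \<open>\<delta>\<close> times the probability that all
  users of \<open>V\<close> hit \<open>T\<close>, and of the double hits.\<close>

lemma bad_prob_approx:
  assumes DS: "D \<le> M * k" and pl: "planted M P c0" and V: "V \<subseteq> {..<nusers M} - P"
    and T: "T \<subseteq> (\<Union>v\<in>P. occupied (c0 v))"
    and f: "\<And>h j. 0 \<le> f h j" and F: "\<And>h j. h < \<theta> \<Longrightarrow> j < n h \<Longrightarrow> f h j \<le> F" "0 \<le> F"
    and \<delta>: "0 \<le> \<delta>"
    and approx: "\<And>x jj. planted M (P \<union> V) (override_on c0 x V) \<Longrightarrow>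
       \<forall>u\<in>V. isolated_user (P \<union> V) (override_on c0 x V) jj u \<Longrightarrow>
       \<bar>expect (rest M (P \<union> V)) (\<lambda>c. of_bool (\<forall>u\<in>V. unresolved (nusers M) (override_on c (override_on c0 x V) (P \<union> V)) l (u, jj u)))
         - (\<Prod>u\<in>V. f (code_of (override_on c0 x V) u) (jj u))\<bar> \<le> \<delta>"
  shows "\<bar>bad_prob M l P c0 T V - (real (card T) / real (M * k) * mean_score f) ^ card V\<bar>
     \<le> \<delta> * (real D * real (card T) / real (M * k)) ^ card V + (1 + (real D * F) ^ card V) *
        (real (card V) * ((real D)\<^sup>2 * real (card T) * real ((card P + card V) * D) / (real (M * k) * real (M * k - 1))
           * (real D * real (card T) / real (M * k)) ^ (card V - 1)))"
proof -
  define S where "S = M * k"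
  define q where "q = (\<lambda>_::nat. user S)"
  have DS': "D \<le> S" using DS by (simp add: S_def)
  have fin: "finite V" using V finite_subset by blast
  have finP: "finite P" "\<forall>u\<in>P. valid S (c0 u)"
    using pl by (auto simp: planted_def S_def intro: finite_subset)
  have TS: "T \<subseteq> {..<S}" using T finP(2) occupied_valid(1) by blast
  have finq: "finite (set_pmf (Pi_pmf A None q))" if "finite A" for A
    using that by (intro finite_set_Pi_pmf) (auto simp: q_def finite_set_user DS')
  have val: "valid S (x u)" if "x \<in> set_pmf (Pi_pmf A None q)" "u \<in> A" "finite A" for x u A
    using that valid_user[OF DS'] by (auto simp: set_Pi_pmf PiE_dflt_def q_def)
  have "expect (Pi_pmf V None q) (\<lambda>x. \<Prod>u\<in>V. score T f (x u)) = (\<Prod>u\<in>V. expect (q u) (score T f))"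
    using fin f by (intro expect_prod_Pi_pmf) (auto simp: q_def finite_set_user DS' score_def intro!: sum_nonneg split: option.split)
  also have "\<dots> = (real (card T) / real S * mean_score f) ^ card V"
    by (simp add: q_def expect_score[OF DS' TS])
  finally have main: "expect (Pi_pmf V None q) (\<lambda>x. \<Prod>u\<in>V. score T f (x u)) = (real (card T) / real S * mean_score f) ^ card V" .
  have two: "expect (Pi_pmf V None q) (\<lambda>x. of_bool (hits2 T (near P c0 V x u) (x u)) * (\<Prod>v\<in>V - {u}. of_bool (hits T (x v))))
     \<le> (real D)\<^sup>2 * real (card T) * real ((card P + card V) * D) / (real S * real (S - 1))
           * (real D * real (card T) / real S) ^ (card V - 1)" (is "_ \<le> ?b * _") if u: "u \<in> V" for u
  proof -
    let ?V = "V - {u}"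
    \<comment> \<open>The slices that are not fresh for \<open>u\<close> depend only on the other
      users. Drawing those first makes the set fixed, and the two-segment bound applies to the
      remaining random user \<open>u\<close>.\<close>
    have "expect (Pi_pmf (?V \<union> {u}) None q) (\<lambda>x. of_bool (hits2 T (near P c0 V x u) (x u)) * (\<Prod>v\<in>?V. of_bool (hits T (x v))))
       = expect (Pi_pmf ?V None q) (\<lambda>x. expect (Pi_pmf {u} None q) (\<lambda>c.
           of_bool (hits2 T (near P c0 V (override_on c x ?V) u) (override_on c x ?V u)) * (\<Prod>v\<in>?V. of_bool (hits T (override_on c x ?V v)))))"
      using fin by (intro expect_Pi_pmf_union) (auto simp: q_def finite_set_user DS')
    also have "\<dots> = expect (Pi_pmf ?V None q) (\<lambda>x. expect (q u) (\<lambda>v. of_bool (hits2 T (near P c0 V x u) v)) * (\<Prod>v\<in>?V. of_bool (hits T (x v))))"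
    proof -
      have "near P c0 V (override_on c x ?V) u = near P c0 V x u" for c x
        by (simp add: near_def)
      moreover have "(\<Prod>v\<in>?V. of_bool (hits T (override_on c x ?V v))) = (\<Prod>v\<in>?V. of_bool (hits T (x v)) :: real)" for c x
        by (intro prod.cong refl) simp
      ultimately show ?thesis by (simp add: Pi_pmf_singleton)
    qed
    also have "\<dots> \<le> expect (Pi_pmf ?V None q) (\<lambda>x. ?b * (\<Prod>v\<in>?V. of_bool (hits T (x v))))"
    proof (intro expect_mono mult_right_mono prod_nonneg finq)
      fix x assume x: "x \<in> set_pmf (Pi_pmf ?V None q)"
      have "near P c0 V x u = near P c0 ?V x u" by (simp add: near_def)
      then have nr: "near P c0 V x u \<subseteq> {..<S}" "card (near P c0 V x u) \<le> (card P + card ?V) * D"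
        using near_subset_card[of P ?V S c0 x u] finP fin val[OF x] by auto
      have "(card P + card ?V) * D \<le> (card P + card V) * D" by (intro mult_le_mono1 add_left_mono card_mono fin) auto
      then have cn: "card (near P c0 V x u) \<le> (card P + card V) * D" by (rule le_trans[OF nr(2)])
      have "expect (q u) (\<lambda>v. of_bool (hits2 T (near P c0 V x u) v))
          \<le> (real D)\<^sup>2 * real (card T) * real (card (near P c0 V x u)) / (real S * real (S - 1))"
        unfolding q_def by (rule expect_hits2_le[OF DS' TS nr(1)])
      also have "\<dots> \<le> ?b"
        by (intro divide_right_mono mult_left_mono) (simp_all only: of_nat_le_iff cn, auto)
      finally show "expect (q u) (\<lambda>v. of_bool (hits2 T (near P c0 V x u) v)) \<le> ?b" .
    qed (use fin in auto)
    also have "\<dots> = ?b * expect (Pi_pmf ?V None q) (\<lambda>x. \<Prod>v\<in>?V. of_bool (hits T (x v)))" by simp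
    also have "\<dots> \<le> ?b * (real D * real (card T) / real S) ^ card ?V"
      unfolding q_def using fin by (intro mult_left_mono expect_prod_hits_le[OF DS' TS]) auto
    also have "card ?V = card V - 1" using u fin by simp
    finally show ?thesis using u by (simp add: insert_absorb)
  qed
  have "\<bar>bad_prob M l P c0 T V - (real (card T) / real S * mean_score f) ^ card V\<bar>
      = \<bar>expect (Pi_pmf V None q) (cond_bad_prob M l P c0 T V) - expect (Pi_pmf V None q) (\<lambda>x. \<Prod>u\<in>V. score T f (x u))\<bar>"
    unfolding main bad_prob_conv_cond[OF DS V] by (simp add: q_def S_def)
  also have "\<dots> \<le> expect (Pi_pmf V None q) (\<lambda>x. \<delta> * (\<Prod>u\<in>V. of_bool (hits T (x u))) + (1 + (real D * F) ^ card V) *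
        (\<Sum>u\<in>V. of_bool (hits2 T (near P c0 V x u) (x u)) * (\<Prod>v\<in>V - {u}. of_bool (hits T (x v)))))"
  proof (rule abs_expect_diff_le[OF finq[OF fin]])
    fix x assume x: "x \<in> set_pmf (Pi_pmf V None q)"
    have vx: "\<forall>u\<in>V. valid (M * k) (x u)" using val[OF x _ fin] by (simp add: S_def)
    have "planted M (P \<union> V) (override_on c0 x V)"
      using pl vx V by (auto simp: planted_def override_on_def)
    from approx[OF this]
    show "\<bar>cond_bad_prob M l P c0 T V x - (\<Prod>u\<in>V. score T f (x u))\<bar>
     \<le> \<delta> * (\<Prod>u\<in>V. of_bool (hits T (x u))) + (1 + (real D * F) ^ card V) *
        (\<Sum>u\<in>V. of_bool (hits2 T (near P c0 V x u) (x u)) * (\<Prod>v\<in>V - {u}. of_bool (hits T (x v))))"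
      by (intro cond_bad_prob_approx[OF DS pl V T vx f F \<delta>])
  qed
  also have "\<dots> = \<delta> * expect (Pi_pmf V None q) (\<lambda>x. \<Prod>u\<in>V. of_bool (hits T (x u))) + (1 + (real D * F) ^ card V) *
        (\<Sum>u\<in>V. expect (Pi_pmf V None q) (\<lambda>x. of_bool (hits2 T (near P c0 V x u) (x u)) * (\<Prod>v\<in>V - {u}. of_bool (hits T (x v)))))"
    by (simp only: expect_add[OF finq[OF fin]] expect_sum[OF finq[OF fin]] integral_mult_right_zero)
  also have "\<dots> \<le> \<delta> * (real D * real (card T) / real S) ^ card V + (1 + (real D * F) ^ card V) *
        (\<Sum>u\<in>V. (real D)\<^sup>2 * real (card T) * real ((card P + card V) * D) / (real S * real (S - 1))
           * (real D * real (card T) / real S) ^ (card V - 1))"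
    using expect_prod_hits_le[OF DS' TS fin] \<delta> F(2) two
    by (intro add_mono mult_left_mono sum_mono) (auto simp: q_def)
  finally show ?thesis by (simp add: S_def)
qed

end

section \<open>Summing the inclusion-exclusion series\<close>

context csa
begin

section \<open>Elementary limits in the number of slices\<close>

text \<open>Both errors for one set \<open>V\<close> carry \<open>S ^ s\<close> in the denominator,
  which balances the number of such sets; the double hits keep a spare factor 1/Q, used with Q one
  less than the number of slices. For \<open>s = 0\<close> the factor \<open>real s\<close> removes
  the truncated exponent \<open>s - 1\<close>.\<close>

lemma collect_scale:
  fixes \<delta> a A B Q S :: real
  shows "\<delta> * (a / S) ^ s + A * (real s * (B / (S * Q) * (a / S) ^ (s - 1)))
       = (\<delta> * a ^ s + A * (real s * (B * a ^ (s - 1))) / Q) / S ^ s"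
  by (cases s) (simp_all add: power_divide add_divide_distrib del: of_nat_Suc)

lemma nusers_le: "real (nusers M) \<le> \<alpha> / real k * real (M * k)"
  using load k_pos by (simp add: nusers_def field_simps)

text \<open>The rounding, the \<open>p\<close> removed users and the shift \<open>i\<close> change
  the numerator by a bounded amount only.\<close>

lemma nusers_ratio_limit: "(\<lambda>M. (real (nusers M - p) - real i) / real (M * k)) \<longlonglongrightarrow> \<alpha> / real k"
proof -
  have "(\<lambda>M. (real (nusers M - p) - real i) / real (M * k) - \<alpha> / real k) \<longlonglongrightarrow> 0"
  proof (rule Lim_null_comparison)
    show "\<forall>\<^sub>F M in sequentially. norm ((real (nusers M - p) - real i) / real (M * k) - \<alpha> / real k)
        \<le> real (1 + p + i) * inverse (real M)"
      using eventually_gt_at_top[of 0]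
    proof eventually_elim
      case (elim M)
      have nn: "0 \<le> \<alpha> * real M" using load by simp
      have "real (nusers M) \<le> \<alpha> * real M" "\<alpha> * real M < real (nusers M) + 1"
        using nn unfolding nusers_def by linarith+
      then have "\<bar>real (nusers M - p) - real i - \<alpha> * real M\<bar> \<le> real (1 + p + i)"
        using nn by (cases "p \<le> nusers M") (auto simp: of_nat_diff)
      then have "\<bar>real (nusers M - p) - real i - \<alpha> * real M\<bar> / real (M * k) \<le> real (1 + p + i) / real (M * k)"
        by (intro divide_right_mono) auto
      also have "\<dots> \<le> real (1 + p + i) / real M"
        using elim k_pos by (intro divide_left_mono) auto
      finally have "\<bar>(real (nusers M - p) - real i - \<alpha> * real M) / real (M * k)\<bar> \<le> real (1 + p + i) / real M"
        by (simp add: abs_divide)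
      moreover have "(real (nusers M - p) - real i - \<alpha> * real M) / real (M * k) = (real (nusers M - p) - real i) / real (M * k) - \<alpha> / real k"
        using elim k_pos by (simp add: diff_divide_distrib)
      ultimately show ?case by (simp add: divide_inverse)
    qed
    show "(\<lambda>M. real (1 + p + i) * inverse (real M)) \<longlonglongrightarrow> 0"
      by (rule tendsto_mult_right_zero[OF lim_inverse_n])
  qed
  then show ?thesis by (simp add: LIM_zero_iff)
qed

text \<open>Counts the sets \<open>V\<close> of size \<open>s\<close> on the scale of the product of
  the single hitting probabilities; this is the Poisson limit of a binomial.\<close>

lemma binomial_ratio_limit:
  "(\<lambda>M. real ((nusers M - p) choose s) / real (M * k) ^ s) \<longlonglongrightarrow> (\<alpha> / real k) ^ s / fact s"
proof -
  have "(\<lambda>M. (\<Prod>i=0..<s. (real (nusers M - p) - real i) / real (M * k)) / fact s) \<longlonglongrightarrow> (\<Prod>i=0..<s. \<alpha> / real k) / fact s"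
    by (intro tendsto_divide tendsto_prod nusers_ratio_limit tendsto_const) simp
  moreover have "(\<Prod>i=0..<s. (real (nusers M - p) - real i) / real (M * k)) / fact s = real ((nusers M - p) choose s) / real (M * k) ^ s" for M
    by (simp add: binomial_gbinomial gbinomial_prod_rev prod_dividef)
  ultimately show ?thesis by simp
qed

lemma slices_inverse_limit: "(\<lambda>M. C / real (M * k - 1)) \<longlonglongrightarrow> 0"
proof (rule Lim_null_comparison)
  show "\<forall>\<^sub>F M in sequentially. norm (C / real (M * k - 1)) \<le> \<bar>C\<bar> * inverse (real (M - 1))"
    using eventually_gt_at_top[of 1]
  proof eventually_elim
    case (elim M)
    have "M - 1 \<le> M * k - 1" using k_pos by (intro diff_le_mono) simp
    then have "\<bar>C\<bar> / real (M * k - 1) \<le> \<bar>C\<bar> / real (M - 1)"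
      using elim by (intro divide_left_mono) (auto simp del: of_nat_diff)
    then show ?case by (simp only: real_norm_def abs_mult abs_inverse abs_of_nat divide_inverse)
  qed
  have "(\<lambda>M. inverse (real (M - 1))) \<longlonglongrightarrow> 0"
    by (rule LIMSEQ_offset[of _ 1]) (simp add: lim_inverse_n)
  then show "(\<lambda>M. \<bar>C\<bar> * inverse (real (M - 1))) \<longlonglongrightarrow> 0" by (rule tendsto_mult_right_zero)
qed

lemma slice_in_occupied:
  assumes "planted M P c" "e \<in> user_edges P c"
  shows "slice_of c e \<in> (\<Union>v\<in>P. occupied (c v))"
proof -
  obtain u j where e: "e = (u, j)" by (cases e)
  with assms(2) obtain h xs where u: "u \<in> P" "c u = Some (h, xs)" "j < n h" by (auto simp: user_edges_def)
  then have "length xs = n h" using assms(1) by (auto simp: planted_def valid_def placements_def)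
  then have "slice_of c e \<in> occupied (c u)" using u by (simp add: e slice_of_def occupied_def)
  then show ?thesis using u(1) by blast
qed

lemma lone_slices:
  assumes "planted M P c" "\<forall>e\<in>E. lone P c e"
  shows "card (slice_of c ` E) = card E" "slice_of c ` E \<subseteq> (\<Union>v\<in>P. occupied (c v))" "slice_of c ` E \<subseteq> {..<M * k}"
proof -
  have "inj_on (slice_of c) E" using assms(2) unfolding lone_def inj_on_def by blast
  then show "card (slice_of c ` E) = card E" by (rule card_image)
  show occ: "slice_of c ` E \<subseteq> (\<Union>v\<in>P. occupied (c v))"
    using slice_in_occupied[OF assms(1)] assms(2) unfolding lone_def by blast
  also have "\<dots> \<subseteq> {..<M * k}" using assms(1) occupied_valid(1) unfolding planted_def by blast
  finally show "slice_of c ` E \<subseteq> {..<M * k}" .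
qed

lemma finite_user_edges:
  assumes "planted M P c"
  shows "finite (user_edges P c)" "card (user_edges P c) \<le> card P * D"
proof -
  have fin: "finite P" using assms by (auto simp: planted_def intro: finite_subset)
  have sub: "user_edges P c \<subseteq> P \<times> {..<D}"
    using assms n_le_D unfolding user_edges_def planted_def valid_def by (force intro: less_le_trans)
  then show "finite (user_edges P c)" using fin finite_subset by blast
  have "card (user_edges P c) \<le> card (P \<times> {..<D})" using fin sub by (intro card_mono) auto
  then show "card (user_edges P c) \<le> card P * D" by (simp add: card_cartesian_product)
qed

section \<open>The inclusion-exclusion series and its limit\<close>

text \<open>The part of the expansion with \<open>card V = s\<close>. The arguments are packed into
  a triple so that they serve as the single parameter of \<open>uniform_tannery\<close>.\<close>

definition bad_sum :: "nat \<Rightarrow> nat \<Rightarrow> nat set \<times> config \<times> (nat \<times> nat) set \<Rightarrow> nat \<Rightarrow> real" where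
  "bad_sum l M = (\<lambda>(P, c0, E) s. (-1) ^ s *
     (\<Sum>V\<in>{V. V \<subseteq> {..<nusers M} - P \<and> card V = s}. bad_prob M l P c0 (slice_of c0 ` E) V))"

text \<open>The number \<open>m\<close> of edges is fixed because the limit of the series depends on
  it.\<close>

definition config_ok :: "nat \<Rightarrow> nat \<Rightarrow> nat \<Rightarrow> nat set \<times> config \<times> (nat \<times> nat) set \<Rightarrow> bool" where
  "config_ok r m M = (\<lambda>(P, c0, E). planted M P c0 \<and> card P \<le> r \<and> (\<forall>e\<in>E. lone P c0 e) \<and> card E = m)"

text \<open>A finite sum in disguise: no \<open>V\<close> has more elements than there are unplanted
  users. As an infinite series its range of summation no longer depends on \<open>M\<close>.\<close>

lemma suminf_bad_sum:
  assumes "D \<le> M * k" "planted M P c0" "\<forall>e\<in>E. lone P c0 e"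
  shows "(\<Sum>s. bad_sum l M (P, c0, E) s)
       = expect (rest M P) (\<lambda>c. of_bool (\<forall>e\<in>E. \<not> collision (nusers M) (override_on c c0 P) l e))"
proof -
  let ?R = "{..<nusers M} - P"
  let ?b = "\<lambda>V. bad_prob M l P c0 (slice_of c0 ` E) V"
  have le: "card V \<le> card ?R" if "V \<subseteq> ?R" for V using that by (intro card_mono) auto
  have "(\<Sum>s. bad_sum l M (P, c0, E) s) = (\<Sum>s\<le>card ?R. bad_sum l M (P, c0, E) s)"
  proof (rule suminf_finite)
    fix s assume "s \<notin> {..card ?R}"
    then have "{V. V \<subseteq> ?R \<and> card V = s} = {}" using le by auto
    then show "bad_sum l M (P, c0, E) s = 0" unfolding bad_sum_def by (simp only: prod.case sum.empty mult_zero_right)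
  qed simp
  also have "\<dots> = (\<Sum>s\<le>card ?R. \<Sum>V\<in>{V \<in> Pow ?R. card V = s}. (-1) ^ card V * ?b V)"
    unfolding bad_sum_def by (auto simp: sum_distrib_left intro!: sum.cong)
  also have "\<dots> = (\<Sum>V\<in>Pow ?R. (-1) ^ card V * ?b V)"
    using le by (intro sum.group) auto
  also have "\<dots> = expect (rest M P) (\<lambda>c. of_bool (\<forall>e\<in>E. \<not> collision (nusers M) (override_on c c0 P) l e))"
    using assms by (intro inclusion_exclusion[symmetric]) (auto simp: planted_def)
  finally show ?thesis .
qed

lemma card_unplanted_subsets:
  assumes "planted M P c0"
  shows "card {V. V \<subseteq> {..<nusers M} - P \<and> card V = s} = (nusers M - card P) choose s"
  using assms finite_subset[of P "{..<nusers M}"] by (simp add: n_subsets card_Diff_subset planted_def)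

lemma binomial_le_ratio: "real ((nusers M - p) choose s) \<le> (\<alpha> / real k * real (M * k)) ^ s / fact s"
proof -
  have "real ((nusers M - p) choose s) * fact s = real (((nusers M - p) choose s) * fact s)" by simp
  also have "\<dots> \<le> real ((nusers M - p) ^ s)" by (simp only: of_nat_le_iff binomial_fact_pow)
  also have "\<dots> = real (nusers M - p) ^ s" by simp
  also have "\<dots> \<le> (\<alpha> / real k * real (M * k)) ^ s"
    using nusers_le[of M] by (intro power_mono) auto
  finally show ?thesis by (simp add: field_simps)
qed

text \<open>The powers of the number of slices cancel between the count of sets and the bound for
  each set, leaving the terms of an exponential series independent of \<open>M\<close>.\<close>

lemma bad_sum_bound:
  assumes "D \<le> M * k" "1 \<le> M * k" "config_ok r m M x"
  shows "\<bar>bad_sum l M x s\<bar> \<le> (\<alpha> / real k * (real D * real m)) ^ s / fact s"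
proof -
  obtain P c0 E where x: "x = (P, c0, E)" by (cases x)
  have ok: "planted M P c0" "\<forall>e\<in>E. lone P c0 e" "card E = m" using assms(3) by (auto simp: config_ok_def x)
  note T = lone_slices[OF ok(1,2)]
  let ?W = "{V. V \<subseteq> {..<nusers M} - P \<and> card V = s}"
  have "\<bar>bad_sum l M x s\<bar> = (\<Sum>V\<in>?W. bad_prob M l P c0 (slice_of c0 ` E) V)"
    by (simp add: bad_sum_def x abs_mult sum_nonneg bad_prob_nonneg)
  also have "\<dots> \<le> (\<Sum>V\<in>?W. (real D * real m / real (M * k)) ^ s)"
    using bad_prob_le[OF assms(1) _ T(3)] T(1) ok(3) by (intro sum_mono) auto
  also have "\<dots> = real ((nusers M - card P) choose s) * (real D * real m / real (M * k)) ^ s"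
    using card_unplanted_subsets[OF ok(1), of s] by simp
  also have "\<dots> \<le> (\<alpha> / real k * real (M * k)) ^ s / fact s * (real D * real m / real (M * k)) ^ s"
    by (intro mult_right_mono binomial_le_ratio) auto
  also have "\<dots> = (\<alpha> / real k * real (M * k) * (real D * real m / real (M * k))) ^ s / fact s"
    unfolding power_mult_distrib[of "\<alpha> / real k * real (M * k)" "real D * real m / real (M * k)"] by simp
  also have "\<alpha> / real k * real (M * k) * (real D * real m / real (M * k)) = \<alpha> / real k * (real D * real m)"
    using assms(2) by simp
  finally show ?thesis .
qed

text \<open>For fixed \<open>s\<close> each set contributes nearly \<open>(y / S) ^ s\<close>, and
  the number of sets is asymptotically a multiple of \<open>S ^ s\<close>. The error splits into
  three thirds: the user claim, the double hits, and the binomial count.\<close>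

lemma bad_sum_limit:
  assumes claim: "user_claim l f" and f: "\<And>h j. 0 \<le> f h j" and \<epsilon>: "0 < \<epsilon>"
  shows "\<forall>\<^sub>F M in sequentially. \<forall>x. config_ok r m M x \<longrightarrow>
     \<bar>bad_sum l M x s - (- (\<alpha> / real k * real m * mean_score f)) ^ s / fact s\<bar> < \<epsilon>"
proof -
  define \<rho> where "\<rho> = \<alpha> / real k"
  have \<rho>: "0 < \<rho>" using load k_pos by (simp add: \<rho>_def)
  define y where "y = real m * mean_score f"
  have y: "0 \<le> y" using mean_score_nonneg[OF f] by (simp add: y_def)
  define F where "F = (\<Sum>h<\<theta>. \<Sum>j<n h. f h j)"
  have F: "f h j \<le> F" if "h < \<theta>" "j < n h" for h j
  proof -
    have "f h j \<le> (\<Sum>j<n h. f h j)" using that f by (intro member_le_sum) auto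
    also have "\<dots> \<le> F" unfolding F_def using that f by (intro member_le_sum[where f = "\<lambda>h. \<Sum>j<n h. f h j"]) (auto intro: sum_nonneg)
    finally show ?thesis .
  qed
  have F0: "0 \<le> F" unfolding F_def using f by (intro sum_nonneg)
  define K where "K = (1 + (real D * F) ^ s) * (real s * ((real D)\<^sup>2 * real m * real ((r + s) * D) * (real D * real m) ^ (s - 1)))"
  \<comment> \<open>The first summand is the factor that \<open>\<delta>\<close> acquires after
    summation over all \<open>V\<close>; adding 1 keeps the divisor positive when \<open>D\<close>
    or \<open>m\<close> is 0.\<close>
  define w where "w = \<rho> ^ s * (real D * real m) ^ s + 1"
  define \<delta> where "\<delta> = \<epsilon> / (3 * w)"
  have den: "0 < w" unfolding w_def using \<rho> by (intro add_nonneg_pos) auto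
  have \<delta>: "0 < \<delta>" using \<epsilon> den by (simp add: \<delta>_def)
  have \<delta>s: "\<rho> ^ s * (\<delta> * (real D * real m) ^ s) \<le> \<epsilon> / 3"
  proof -
    have "\<rho> ^ s * (\<delta> * (real D * real m) ^ s) = \<delta> * (\<rho> ^ s * (real D * real m) ^ s)" by simp
    also have "\<dots> \<le> \<delta> * w" using \<delta> by (intro mult_left_mono) (auto simp: w_def)
    also have "\<dots> = \<epsilon> / 3" using den by (simp add: \<delta>_def)
    finally show ?thesis .
  qed
  \<comment> \<open>The bound is \<open>r + s\<close> because the \<open>s\<close> users of
    \<open>V\<close> are planted in addition to \<open>P\<close>.\<close>
  have ev1: "\<forall>\<^sub>F M in sequentially. \<forall>P c0 V jj.
     planted M P c0 \<and> card P \<le> r + s \<and> V \<subseteq> P \<and> (\<forall>u\<in>V. isolated_user P c0 jj u) \<longrightarrow>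
     \<bar>expect (rest M P) (\<lambda>c. of_bool (\<forall>u\<in>V. unresolved (nusers M) (override_on c c0 P) l (u, jj u)))
       - (\<Prod>u\<in>V. f (code_of c0 u) (jj u))\<bar> < \<delta>"
    using spec[OF claim[unfolded user_claim_def], of "r + s"] \<delta> by blast
  have ev2: "\<forall>\<^sub>F M in sequentially. \<rho> ^ s * K / real (M * k - 1) < \<epsilon> / 3"
    using order_tendstoD(2)[OF slices_inverse_limit, of "\<epsilon> / 3"] \<epsilon> by simp
  \<comment> \<open>The binomial count depends on \<open>card P\<close>, which takes only finitely
    many values, so the limits hold uniformly.\<close>
  have ev3: "\<forall>\<^sub>F M in sequentially. \<forall>p\<in>{..r}. \<bar>real ((nusers M - p) choose s) / real (M * k) ^ s - \<rho> ^ s / fact s\<bar> < \<epsilon> / (3 * (y ^ s + 1))"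
  proof (intro eventually_ball_finite ballI)
    fix p
    have "0 < \<epsilon> / (3 * (y ^ s + 1))" using \<epsilon> y by (intro divide_pos_pos mult_pos_pos add_nonneg_pos) auto
    from tendstoD[OF binomial_ratio_limit[of p s] this]
    show "\<forall>\<^sub>F M in sequentially. \<bar>real ((nusers M - p) choose s) / real (M * k) ^ s - \<rho> ^ s / fact s\<bar> < \<epsilon> / (3 * (y ^ s + 1))"
      by (simp add: dist_real_def \<rho>_def)
  qed simp
  show ?thesis
    using ev1 ev2 ev3 eventually_slices[of D] eventually_slices[of 2]
  proof (eventually_elim, intro allI impI)
    fix M x
    assume A1: "\<forall>P c0 V jj.
     planted M P c0 \<and> card P \<le> r + s \<and> V \<subseteq> P \<and> (\<forall>u\<in>V. isolated_user P c0 jj u) \<longrightarrow>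
     \<bar>expect (rest M P) (\<lambda>c. of_bool (\<forall>u\<in>V. unresolved (nusers M) (override_on c c0 P) l (u, jj u)))
       - (\<Prod>u\<in>V. f (code_of c0 u) (jj u))\<bar> < \<delta>"
      and A2: "\<rho> ^ s * K / real (M * k - 1) < \<epsilon> / 3"
      and A3: "\<forall>p\<in>{..r}. \<bar>real ((nusers M - p) choose s) / real (M * k) ^ s - \<rho> ^ s / fact s\<bar> < \<epsilon> / (3 * (y ^ s + 1))"
      and DS: "D \<le> M * k" and S2: "2 \<le> M * k" and ok: "config_ok r m M x"
    define S where "S = real (M * k)"
    have S: "0 < S" using S2 unfolding S_def of_nat_0_less_iff by linarith
    have S1: "0 < real (M * k - 1)" using S2 by simp
    obtain P c0 E where x: "x = (P, c0, E)" by (cases x)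
    have pl: "planted M P c0" and cP: "card P \<le> r" and lone: "\<forall>e\<in>E. lone P c0 e" and cE: "card E = m"
      using ok by (auto simp: config_ok_def x)
    note T = lone_slices[OF pl lone]
    let ?T = "slice_of c0 ` E" and ?W = "{V. V \<subseteq> {..<nusers M} - P \<and> card V = s}"
    let ?N = "real ((nusers M - card P) choose s)"
    have cW: "real (card ?W) = ?N" by (simp add: card_unplanted_subsets[OF pl])
    have each: "\<bar>bad_prob M l P c0 ?T V - (y / S) ^ s\<bar> \<le> (\<delta> * (real D * real m) ^ s + K / real (M * k - 1)) / S ^ s"
      if V: "V \<in> ?W" for V
    proof -
      have VR: "V \<subseteq> {..<nusers M} - P" and cV: "card V = s" using V by auto
      have cPV: "card (P \<union> V) \<le> r + s" using card_Un_le[of P V] cP cV by simp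
      have "\<bar>bad_prob M l P c0 ?T V - (real (card ?T) / real (M * k) * mean_score f) ^ card V\<bar>
         \<le> \<delta> * (real D * real (card ?T) / real (M * k)) ^ card V + (1 + (real D * F) ^ card V) *
            (real (card V) * ((real D)\<^sup>2 * real (card ?T) * real ((card P + card V) * D) / (real (M * k) * real (M * k - 1))
            * (real D * real (card ?T) / real (M * k)) ^ (card V - 1)))"
      proof (rule bad_prob_approx[OF DS pl VR T(2) f F F0 less_imp_le[OF \<delta>]])
        fix x jj
        assume "planted M (P \<union> V) (override_on c0 x V)" "\<forall>u\<in>V. isolated_user (P \<union> V) (override_on c0 x V) jj u"
        then show "\<bar>expect (rest M (P \<union> V)) (\<lambda>c. of_bool (\<forall>u\<in>V. unresolved (nusers M) (override_on c (override_on c0 x V) (P \<union> V)) l (u, jj u)))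
         - (\<Prod>u\<in>V. f (code_of (override_on c0 x V) u) (jj u))\<bar> \<le> \<delta>"
          using A1 cPV by (intro less_imp_le) blast
      qed
      also have "\<dots> = \<delta> * (real D * real m / S) ^ s + (1 + (real D * F) ^ s) *
            (real s * ((real D)\<^sup>2 * real m * real ((card P + s) * D) / (S * real (M * k - 1))
            * (real D * real m / S) ^ (s - 1)))"
        by (simp only: T(1) cE cV S_def)
      also have "\<dots> \<le> \<delta> * (real D * real m / S) ^ s + (1 + (real D * F) ^ s) *
            (real s * ((real D)\<^sup>2 * real m * real ((r + s) * D) / (S * real (M * k - 1))
            * (real D * real m / S) ^ (s - 1)))"
        using cP S S1 F0
        by (intro add_left_mono mult_left_mono mult_right_mono divide_right_mono) (simp_all del: of_nat_mult add: mult_right_mono)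
      also have "\<dots> = (\<delta> * (real D * real m) ^ s + K / real (M * k - 1)) / S ^ s"
        unfolding K_def by (rule collect_scale)
      finally show ?thesis by (simp add: T(1) cE cV S_def y_def)
    qed
    have p1: "\<bar>(\<Sum>V\<in>?W. bad_prob M l P c0 ?T V) - ?N * (y / S) ^ s\<bar> \<le> \<rho> ^ s * (\<delta> * (real D * real m) ^ s + K / real (M * k - 1))"
    proof -
      have "\<bar>(\<Sum>V\<in>?W. bad_prob M l P c0 ?T V) - ?N * (y / S) ^ s\<bar> = \<bar>\<Sum>V\<in>?W. bad_prob M l P c0 ?T V - (y / S) ^ s\<bar>"
        by (simp only: sum_subtractf sum_constant cW)
      also have "\<dots> \<le> (\<Sum>V\<in>?W. (\<delta> * (real D * real m) ^ s + K / real (M * k - 1)) / S ^ s)"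
        using each by (intro order_trans[OF sum_abs] sum_mono)
      also have "\<dots> = ?N * ((\<delta> * (real D * real m) ^ s + K / real (M * k - 1)) / S ^ s)"
        by (simp only: sum_constant cW)
      also have "\<dots> \<le> (\<rho> * S) ^ s * ((\<delta> * (real D * real m) ^ s + K / real (M * k - 1)) / S ^ s)"
      proof (rule mult_right_mono)
        have "?N \<le> (\<rho> * S) ^ s / fact s" unfolding \<rho>_def S_def by (rule binomial_le_ratio)
        also have "\<dots> \<le> (\<rho> * S) ^ s / 1" using \<rho> S by (intro divide_left_mono) auto
        finally show "?N \<le> (\<rho> * S) ^ s" by simp
        show "0 \<le> (\<delta> * (real D * real m) ^ s + K / real (M * k - 1)) / S ^ s"
          using \<delta> S F0 by (auto simp: K_def intro!: divide_nonneg_nonneg add_nonneg_nonneg mult_nonneg_nonneg)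
      qed
      also have "\<dots> = \<rho> ^ s * (\<delta> * (real D * real m) ^ s + K / real (M * k - 1))"
        using S by (simp add: power_mult_distrib)
      finally show ?thesis .
    qed
    have p2: "\<bar>?N * (y / S) ^ s - (\<rho> * y) ^ s / fact s\<bar> < \<epsilon> / 3"
    proof -
      have ys: "0 \<le> y ^ s" using y by simp
      have "?N * (y / S) ^ s - (\<rho> * y) ^ s / fact s = y ^ s * (?N / S ^ s - \<rho> ^ s / fact s)"
        by (simp add: power_divide power_mult_distrib algebra_simps)
      then have "\<bar>?N * (y / S) ^ s - (\<rho> * y) ^ s / fact s\<bar> = y ^ s * \<bar>?N / S ^ s - \<rho> ^ s / fact s\<bar>"
        using ys by (simp add: abs_mult)
      also have "\<dots> \<le> y ^ s * (\<epsilon> / (3 * (y ^ s + 1)))"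
        using bspec[OF A3, of "card P"] cP ys unfolding S_def by (intro mult_left_mono) simp_all
      also have "\<dots> < \<epsilon> / 3" using ys \<epsilon> by (simp add: field_simps)
      finally show ?thesis .
    qed
    have "\<bar>(\<Sum>V\<in>?W. bad_prob M l P c0 ?T V) - (\<rho> * y) ^ s / fact s\<bar> < \<epsilon>"
    proof -
      have "\<rho> ^ s * (\<delta> * (real D * real m) ^ s + K / real (M * k - 1)) \<le> \<epsilon> / 3 + \<epsilon> / 3"
        unfolding distrib_left times_divide_eq_right by (intro add_mono \<delta>s less_imp_le[OF A2])
      with p1 p2 show ?thesis by linarith
    qed
    moreover have "\<bar>bad_sum l M x s - (- (\<rho> * y)) ^ s / fact s\<bar> = \<bar>(\<Sum>V\<in>?W. bad_prob M l P c0 ?T V) - (\<rho> * y) ^ s / fact s\<bar>"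
    proof -
      have "bad_sum l M x s - (- (\<rho> * y)) ^ s / fact s = (-1) ^ s * ((\<Sum>V\<in>?W. bad_prob M l P c0 ?T V) - (\<rho> * y) ^ s / fact s)"
        unfolding bad_sum_def x power_minus[of "\<rho> * y"] by (simp add: right_diff_distrib)
      then show ?thesis by (simp add: abs_mult)
    qed
    ultimately show "\<bar>bad_sum l M x s - (- (\<alpha> / real k * real m * mean_score f)) ^ s / fact s\<bar> < \<epsilon>"
      by (simp add: \<rho>_def y_def mult.assoc)
  qed
qed

text \<open>The limiting terms form the series of exp(-z) with z proportional to the number
  \<open>m\<close> of edges. Hence the limit is an \<open>m\<close>-th power, which is the
  independence of the edges demanded by the claim.\<close>

lemma slice_claim_of_user_claim:
  assumes claim: "user_claim l f" and f: "\<And>h j. 0 \<le> f h j"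
  shows "slice_claim l (exp (- (\<alpha> / real k) * mean_score f))"
  unfolding slice_claim_def
proof (intro allI impI)
  fix r :: nat and \<epsilon> :: real assume \<epsilon>: "0 < \<epsilon>"
  let ?a = "exp (- (\<alpha> / real k) * mean_score f)"
  have each: "\<forall>\<^sub>F M in sequentially. \<forall>x. config_ok r m M x \<longrightarrow> \<bar>(\<Sum>s. bad_sum l M x s) - ?a ^ m\<bar> < \<epsilon>" for m
  proof -
    let ?b = "\<alpha> / real k * (real D * real m)"
    define z where "z = \<alpha> / real k * real m * mean_score f"
    have z: "0 \<le> z" unfolding z_def using load mean_score_nonneg[OF f] by simp
    have b: "0 \<le> ?b" using load by simp
    have sm: "summable (\<lambda>s. x ^ s / fact s)" for x :: real
      using summable_exp[of x] by (simp add: divide_inverse mult.commute)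
    have "\<forall>\<^sub>F M in sequentially. \<forall>x. config_ok r m M x \<longrightarrow> \<bar>(\<Sum>s. bad_sum l M x s) - (\<Sum>s. (- z) ^ s / fact s)\<bar> < \<epsilon>"
    \<comment> \<open>The first summand dominates the terms for finite \<open>M\<close>, the second
      one the limiting terms.\<close>
    proof (rule uniform_tannery[where B = "\<lambda>s. ?b ^ s / fact s + z ^ s / fact s"])
      show "\<forall>\<^sub>F M in sequentially. \<forall>x. config_ok r m M x \<longrightarrow> \<bar>bad_sum l M x s - (- z) ^ s / fact s\<bar> < e" if "0 < e" for s e
        unfolding z_def by (rule bad_sum_limit[OF claim f that])
      show "\<forall>\<^sub>F M in sequentially. \<forall>x s. config_ok r m M x \<longrightarrow> \<bar>bad_sum l M x s\<bar> \<le> ?b ^ s / fact s + z ^ s / fact s"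
        using eventually_slices[of D] eventually_slices[of 1]
      proof (eventually_elim, intro allI impI)
        fix M x s assume "D \<le> M * k" "1 \<le> M * k" "config_ok r m M x"
        then have "\<bar>bad_sum l M x s\<bar> \<le> ?b ^ s / fact s" by (rule bad_sum_bound)
        moreover have "0 \<le> z ^ s / fact s" using z by (intro divide_nonneg_nonneg zero_le_power) auto
        ultimately show "\<bar>bad_sum l M x s\<bar> \<le> ?b ^ s / fact s + z ^ s / fact s" by linarith
      qed
      show "\<bar>(- z) ^ s / fact s\<bar> \<le> ?b ^ s / fact s + z ^ s / fact s" for s
      proof -
        have "\<bar>(- z) ^ s / fact s\<bar> = z ^ s / fact s" using z by (simp add: power_abs)
        moreover have "0 \<le> ?b ^ s / fact s" using b by (intro divide_nonneg_nonneg zero_le_power) auto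
        ultimately show ?thesis by linarith
      qed
      show "summable (\<lambda>s. ?b ^ s / fact s + z ^ s / fact s)" by (intro summable_add sm)
    qed (rule \<epsilon>)
    moreover have "(\<Sum>s. (- z) ^ s / fact s) = exp (- z)" by (simp add: exp_def divide_inverse mult.commute)
    moreover have "exp (- z) = ?a ^ m" unfolding z_def exp_of_nat_mult[symmetric] by (simp add: mult.commute mult.left_commute)
    ultimately show ?thesis by simp
  qed
  \<comment> \<open>Lone edges belong to at most \<open>r\<close> planted users, so only finitely
    many values of \<open>m\<close> occur.\<close>
  have "\<forall>\<^sub>F M in sequentially. \<forall>m\<in>{..r * D}. \<forall>x. config_ok r m M x \<longrightarrow> \<bar>(\<Sum>s. bad_sum l M x s) - ?a ^ m\<bar> < \<epsilon>"
    by (intro eventually_ball_finite ballI each) simp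
  then show "\<forall>\<^sub>F M in sequentially. \<forall>P c0 E. planted M P c0 \<and> card P \<le> r \<and> (\<forall>e\<in>E. lone P c0 e) \<longrightarrow>
     \<bar>expect (rest M P) (\<lambda>c. of_bool (\<forall>e\<in>E. \<not> collision (nusers M) (override_on c c0 P) l e)) - ?a ^ card E\<bar> < \<epsilon>"
    using eventually_slices[of D]
  proof (eventually_elim, intro allI impI)
    fix M P c0 E
    assume A: "\<forall>m\<in>{..r * D}. \<forall>x. config_ok r m M x \<longrightarrow> \<bar>(\<Sum>s. bad_sum l M x s) - ?a ^ m\<bar> < \<epsilon>"
      and DS: "D \<le> M * k" and B: "planted M P c0 \<and> card P \<le> r \<and> (\<forall>e\<in>E. lone P c0 e)"
    have "card E \<le> card (user_edges P c0)"
      using B finite_user_edges(1)[of M P c0] by (intro card_mono) (auto simp: lone_def)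
    also have "\<dots> \<le> r * D" using finite_user_edges(2)[of M P c0] B by (meson le_trans mult_le_mono1)
    finally have "card E \<in> {..r * D}" by simp
    moreover have "config_ok r (card E) M (P, c0, E)" using B by (simp add: config_ok_def)
    ultimately have "\<bar>(\<Sum>s. bad_sum l M (P, c0, E) s) - ?a ^ card E\<bar> < \<epsilon>" using A by blast
    then show "\<bar>expect (rest M P) (\<lambda>c. of_bool (\<forall>e\<in>E. \<not> collision (nusers M) (override_on c c0 P) l e)) - ?a ^ card E\<bar> < \<epsilon>"
      using suminf_bad_sum[OF DS] B by simp
  qed
qed

end

section \<open>The limit of the collision probability\<close>

context csa
begin

text \<open>The limit of \<open>1 - p\<^sub>l\<close>.\<close>

primrec limit_clear :: "nat \<Rightarrow> real" where
  "limit_clear 0 = exp (- (\<alpha> / real k) * mean_score (\<lambda>_ _. 1))"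
| "limit_clear (Suc l) = exp (- (\<alpha> / real k) * mean_score (\<lambda>h. erasure_prob (G h) k (n h) (limit_clear l)))"

text \<open>The bounds 0 and 1 are carried along because the erasure probability is known to be
  nonnegative, and the multilinear comparison is made, only for such values.\<close>

lemma slice_claim_limit_clear:
  "slice_claim l (limit_clear l) \<and> 0 \<le> limit_clear l \<and> limit_clear l \<le> 1"
proof -
  have le1: "exp (- (\<alpha> / real k) * mean_score f) \<le> 1" if "\<And>h j. 0 \<le> f h j" for f
    using mean_score_nonneg[OF that] load by simp
  show ?thesis
  proof (induction l)
    case 0
    show ?case using slice_claim_of_user_claim[OF user_claim_0] le1[of "\<lambda>_ _. 1"] by simp
  next
    case (Suc l)
    let ?f = "\<lambda>h. erasure_prob (G h) k (n h) (limit_clear l)"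
    have f: "0 \<le> ?f h j" for h j using Suc by (intro erasure_prob_nonneg) auto
    have "user_claim (Suc l) ?f" using Suc by (intro user_claim_Suc) auto
    then have "slice_claim (Suc l) (limit_clear (Suc l))"
      unfolding limit_clear.simps using f by (rule slice_claim_of_user_claim)
    then show ?case using le1[OF f] by simp
  qed
qed

section \<open>Edge counts and the ratio \<open>p_fin\<close>\<close>

definition deg :: "(nat \<times> nat list) option \<Rightarrow> nat" where
  "deg v = (case v of None \<Rightarrow> 0 | Some (h, xs) \<Rightarrow> n h)"

lemma user_edges_deg: "user_edges P c = (SIGMA u:P. {..<deg (c u)})"
  by (auto simp: user_edges_def deg_def split: option.splits)

lemma expect_deg:
  assumes "D \<le> S" "1 \<le> S"
  shows "expect (user S) (\<lambda>v. real (deg v)) = mean_score (\<lambda>_ _. 1)"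
proof -
  have "expect (user S) (\<lambda>v. real (deg v)) = expect (user S) (score {..<S} (\<lambda>_ _. 1))"
  proof (rule expect_cong)
    fix v assume "v \<in> set_pmf (user S)"
    then have v: "valid S v" by (rule valid_user[OF assms(1)])
    show "real (deg v) = score {..<S} (\<lambda>_ _. 1) v"
    proof (cases v)
      case (Some w)
      obtain h xs where vs: "v = Some (h, xs)" using Some by (cases w) auto
      then have "xs \<in> placements (n h) S" using v by (simp add: valid_def)
      then have "(\<Sum>j<n h. of_bool (xs ! j \<in> {..<S}) * 1) = (\<Sum>j<n h. 1 :: real)"
        by (intro sum.cong refl) (simp add: placements_nth)
      then show ?thesis unfolding vs deg_def score_def by simp
    qed (simp add: deg_def score_def)
  qed
  then show ?thesis using assms by (simp add: expect_score)
qed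

lemma config_pmf_eq: "config_pmf (nusers M) (M * k) \<pi> \<Lambda> n = rest M {}"
  by (simp add: config_pmf_def rest_def)

text \<open>Reveals one user before the others, the step from the random frame to a single planted
  user.\<close>

lemma expect_rest_user:
  assumes "D \<le> M * k" "u < nusers M"
  shows "expect (rest M {}) F = expect (user (M * k)) (\<lambda>v. expect (rest M {u}) (\<lambda>c. F (override_on c (\<lambda>_. v) {u})))"
proof -
  have split: "{..<nusers M} = {u} \<union> ({..<nusers M} - {u})" using assms by auto
  have ov: "override_on c (\<lambda>b. if b = u then v else None) {u} = override_on c (\<lambda>_. v) {u}" for c :: config and v
    by (simp add: override_on_def fun_eq_iff)
  have "expect (Pi_pmf ({u} \<union> ({..<nusers M} - {u})) None (\<lambda>_. user (M * k))) F
      = expect (Pi_pmf {u} None (\<lambda>_. user (M * k))) (\<lambda>x. expect (rest M {u}) (\<lambda>c. F (override_on c x {u})))"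
    unfolding rest_def using assms(1) by (intro expect_Pi_pmf_union) (auto simp: finite_set_user)
  then show ?thesis using split by (simp add: rest_def Pi_pmf_singleton ov)
qed

lemma card_edges: "real (card (edges n (nusers M) c)) = (\<Sum>u<nusers M. real (deg (c u)))"
  by (simp add: edges_eq user_edges_deg)

lemma card_collisions:
  "real (card {e \<in> edges n N c. collision N c l e}) = (\<Sum>u<N. \<Sum>j<deg (c u). of_bool (collision N c l (u, j)))"
proof -
  have fin: "finite (edges n N c)" by (simp add: edges_eq user_edges_deg)
  have "real (card {e \<in> edges n N c. collision N c l e}) = (\<Sum>e\<in>edges n N c. of_bool (collision N c l e))"
    using fin by (simp add: Int_def)
  also have "\<dots> = (\<Sum>u<N. \<Sum>j<deg (c u). of_bool (collision N c l (u, j)))"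
    unfolding edges_eq user_edges_deg by (subst sum.Sigma) (auto simp: case_prod_unfold)
  finally show ?thesis .
qed

lemma expect_edges:
  assumes "D \<le> M * k" "1 \<le> M * k"
  shows "expect (rest M {}) (\<lambda>c. real (card (edges n (nusers M) c))) = real (nusers M) * mean_score (\<lambda>_ _. 1)"
proof -
  have "expect (rest M {}) (\<lambda>c. real (card (edges n (nusers M) c)))
      = (\<Sum>u<nusers M. expect (rest M {}) (\<lambda>c. real (deg (c u))))"
    unfolding card_edges by (rule expect_sum[OF finite_set_rest[OF assms(1)]])
  also have "\<dots> = (\<Sum>u<nusers M. mean_score (\<lambda>_ _. 1))"
    by (intro sum.cong refl) (simp add: expect_rest_user[OF assms(1)] expect_deg[OF assms])
  finally show ?thesis by simp
qed

text \<open>Each user is planted in turn, with all others random. Every edge then has collision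
  probability close to the limit, uniformly in the user's code and slices, so weighting by the
  number of edges gives the same limit for the ratio of expectations.\<close>

lemma p_fin_limit:
  assumes pos: "0 < mean_score (\<lambda>_ _. 1)"
  shows "(\<lambda>M. p_fin G k n \<Lambda> \<pi> \<alpha> M l) \<longlonglongrightarrow> 1 - limit_clear l"
proof (rule tendstoI)
  fix e :: real assume e: "0 < e"
  let ?a = "limit_clear l" and ?y = "mean_score (\<lambda>_ _. 1)"
  have "\<forall>\<^sub>F M in sequentially. \<forall>P c0 E.
     planted M P c0 \<and> card P \<le> 1 \<and> (\<forall>e\<in>E. lone P c0 e) \<longrightarrow>
     \<bar>expect (rest M P) (\<lambda>c. of_bool (\<forall>e\<in>E. \<not> collision (nusers M) (override_on c c0 P) l e)) - ?a ^ card E\<bar> < e / 2"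
    using slice_claim_limit_clear[of l] half_gt_zero[OF e] unfolding slice_claim_def by blast
  moreover have "\<forall>\<^sub>F M in sequentially. 0 < nusers M"
  proof -
    have "0 < \<alpha> / real k" using load k_pos by simp
    then have "\<forall>\<^sub>F M in sequentially. 0 < (real (nusers M - 0) - real 0) / real (M * k)"
      by (rule order_tendstoD(1)[OF nusers_ratio_limit])
    then show ?thesis by eventually_elim (auto simp: zero_less_divide_iff)
  qed
  ultimately show "\<forall>\<^sub>F M in sequentially. dist (p_fin G k n \<Lambda> \<pi> \<alpha> M l) (1 - ?a) < e"
    using eventually_slices[of D] eventually_slices[of 1]
  proof eventually_elim
    case (elim M)
    note DS = elim(3)
    let ?N = "nusers M"
    have each: "\<bar>expect (rest M {u}) (\<lambda>c. of_bool (collision ?N (override_on c (\<lambda>_. v) {u}) l (u, j))) - (1 - ?a)\<bar> \<le> e / 2"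
      if u: "u < ?N" and v: "v \<in> set_pmf (user (M * k))" and j: "j < deg v" for u v j
    proof -
      have val: "valid (M * k) v" using v by (rule valid_user[OF DS])
      obtain h xs where vs: "v = Some (h, xs)" "j < n h" using j by (cases v) (auto simp: deg_def)
      have xs: "distinct xs" "length xs = n h" using val vs by (auto simp: valid_def placements_def)
      have "planted M {u} (\<lambda>_. v)" using u val by (simp add: planted_def)
      \<comment> \<open>With a single planted user every edge is alone, since its segments lie in
        distinct slices.\<close>
      moreover have "lone {u} (\<lambda>_. v) (u, j)"
        using vs xs by (auto simp: lone_def user_edges_def slice_of_def nth_eq_iff_index_eq)
      ultimately have "\<bar>expect (rest M {u}) (\<lambda>c. of_bool (\<forall>e\<in>{(u, j)}. \<not> collision ?N (override_on c (\<lambda>_. v) {u}) l e)) - ?a ^ card {(u, j)}\<bar> < e / 2"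
        using elim(1)[rule_format, of "{u}" "\<lambda>_. v" "{(u, j)}"] by simp
      moreover have "expect (rest M {u}) (\<lambda>c. of_bool (\<forall>e\<in>{(u, j)}. \<not> collision ?N (override_on c (\<lambda>_. v) {u}) l e))
          = expect (rest M {u}) (\<lambda>c. 1 - of_bool (collision ?N (override_on c (\<lambda>_. v) {u}) l (u, j)))"
        by (rule expect_cong) simp
      moreover have "\<bar>X - (1 - ?a)\<bar> \<le> e / 2" if "\<bar>1 - X - ?a ^ 1\<bar> < e / 2" for X :: real
        using that unfolding power_one_right by linarith
      ultimately show ?thesis
        by (simp only: expect_diff[OF finite_set_rest[OF DS]]) simp
    qed
    have per_user: "\<bar>expect (rest M {}) (\<lambda>c. \<Sum>j<deg (c u). of_bool (collision ?N c l (u, j))) - ?y * (1 - ?a)\<bar> \<le> ?y * (e / 2)"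
      if u: "u < ?N" for u
    proof -
      have "expect (rest M {}) (\<lambda>c. \<Sum>j<deg (c u). of_bool (collision ?N c l (u, j)))
          = expect (user (M * k)) (\<lambda>v. \<Sum>j<deg v. expect (rest M {u}) (\<lambda>c. of_bool (collision ?N (override_on c (\<lambda>_. v) {u}) l (u, j))))"
        unfolding expect_rest_user[OF DS u] expect_sum[OF finite_set_rest[OF DS], symmetric]
        by (simp only: override_on_apply_in[OF singletonI])
      moreover have "?y * (1 - ?a) = expect (user (M * k)) (\<lambda>v. real (deg v) * (1 - ?a))"
        by (simp add: expect_deg[OF DS elim(4)])
      moreover have "\<bar>expect (user (M * k)) (\<lambda>v. \<Sum>j<deg v. expect (rest M {u}) (\<lambda>c. of_bool (collision ?N (override_on c (\<lambda>_. v) {u}) l (u, j))))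
          - expect (user (M * k)) (\<lambda>v. real (deg v) * (1 - ?a))\<bar> \<le> expect (user (M * k)) (\<lambda>v. real (deg v) * (e / 2))"
      proof (rule abs_expect_diff_le[OF finite_set_user[OF DS]])
        fix v assume v: "v \<in> set_pmf (user (M * k))"
        let ?q = "\<lambda>j. expect (rest M {u}) (\<lambda>c. of_bool (collision ?N (override_on c (\<lambda>_. v) {u}) l (u, j)))"
        have "\<bar>(\<Sum>j<deg v. ?q j) - real (deg v) * (1 - ?a)\<bar> = \<bar>\<Sum>j<deg v. ?q j - (1 - ?a)\<bar>"
          by (simp only: sum_subtractf sum_constant card_lessThan right_diff_distrib)
        also have "\<dots> \<le> (\<Sum>j<deg v. e / 2)"
          using each[OF u v] by (intro order_trans[OF sum_abs] sum_mono) auto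
        finally show "\<bar>(\<Sum>j<deg v. ?q j) - real (deg v) * (1 - ?a)\<bar> \<le> real (deg v) * (e / 2)" by simp
      qed
      moreover have "expect (user (M * k)) (\<lambda>v. real (deg v) * (e / 2)) = ?y * (e / 2)"
        by (simp add: expect_deg[OF DS elim(4)])
      ultimately show ?thesis by (simp only:)
    qed
    let ?num = "expect (rest M {}) (\<lambda>c. real (card {e \<in> edges n ?N c. collision ?N c l e}))"
    have diff: "?num - real ?N * ?y * (1 - ?a)
        = (\<Sum>u<?N. expect (rest M {}) (\<lambda>c. \<Sum>j<deg (c u). of_bool (collision ?N c l (u, j))) - ?y * (1 - ?a))"
      unfolding card_collisions expect_sum[OF finite_set_rest[OF DS], where I = "{..<?N}"]
      by (simp only: sum_subtractf sum_constant card_lessThan mult.assoc)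
    have "\<bar>?num - real ?N * ?y * (1 - ?a)\<bar> \<le> (\<Sum>u<?N. ?y * (e / 2))"
      unfolding diff using per_user by (intro order_trans[OF sum_abs] sum_mono) auto
    then have num: "\<bar>?num - real ?N * ?y * (1 - ?a)\<bar> \<le> real ?N * ?y * (e / 2)"
      by (simp only: sum_constant card_lessThan mult.assoc)
    have Ny: "0 < real ?N * ?y" using elim(2) pos by simp
    have "p_fin G k n \<Lambda> \<pi> \<alpha> M l = ?num / (real ?N * ?y)"
      unfolding p_fin_def Let_def nusers_def[symmetric] config_pmf_eq expect_edges[OF DS elim(4)] ..
    moreover have "\<bar>x / d - b\<bar> \<le> e / 2" if "\<bar>x - d * b\<bar> \<le> d * (e / 2)" "0 < d" for x d b :: real
    proof -
      have "x / d - b = (x - d * b) / d" using that(2) by (simp add: diff_divide_distrib)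
      then have "\<bar>x / d - b\<bar> = \<bar>x - d * b\<bar> / d" using that(2) by (simp add: abs_divide)
      then show ?thesis using that by (simp only: pos_divide_le_eq mult.commute)
    qed
    ultimately have "\<bar>p_fin G k n \<Lambda> \<pi> \<alpha> M l - (1 - ?a)\<bar> \<le> e / 2"
      using num Ny by (simp only:)
    then show ?case using e unfolding dist_real_def by linarith
  qed
qed

end

text \<open>The recursion holds between limits: \<open>q\<close> is the limit at level
  \<open>l - 1\<close>, and uniqueness of limits identifies it with the value that the formula gives
  one level earlier.\<close>

theorem mainTheorem3:
  fixes k \<theta> :: nat and n :: "nat \<Rightarrow> nat" and G :: "nat \<Rightarrow> nat \<Rightarrow> nat \<Rightarrow> bool"
    and \<Lambda> :: "nat pmf" and \<pi> \<alpha> :: real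
  assumes "k \<ge> 1" and "\<theta> \<ge> 1"
    and "set_pmf \<Lambda> \<subseteq> {..<\<theta>}"
    and "\<And>h. h < \<theta> \<Longrightarrow> good_code (G h) k (n h)"
    and "0 < \<pi>" and "\<pi> \<le> 1" and "0 < \<alpha>"
  defines "nbar \<equiv> (\<Sum>h<\<theta>. pmf \<Lambda> h * real (n h))"
  defines "R \<equiv> real k / nbar"
  shows "(\<lambda>M. p_fin G k n \<Lambda> \<pi> \<alpha> M 0) \<longlonglongrightarrow> 1 - exp (- \<pi> * \<alpha> / R)
       \<and> (\<forall>l\<ge>1. \<exists>q. (\<lambda>M. p_fin G k n \<Lambda> \<pi> \<alpha> M (l - 1)) \<longlonglongrightarrow> q
            \<and> (\<lambda>M. p_fin G k n \<Lambda> \<pi> \<alpha> M l) \<longlonglongrightarrow>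
                1 - exp (- (\<pi> * \<alpha> / real k) * (\<Sum>h<\<theta>. pmf \<Lambda> h *
                   (\<Sum>t<n h. q ^ t * (1 - q) ^ (n h - 1 - t) *
                      (real (n h - t) * real (info_fun (G h) k (n h) (n h - t))
                       - real (t + 1) * real (info_fun (G h) k (n h) (n h - 1 - t)))))))"
proof -
  interpret csa k \<theta> n G \<Lambda> \<pi> \<alpha>
    using assms(1,3,5-7) by unfold_locales
  \<comment> \<open>A code of length 0 has rank 0, contrary to full rank \<open>k\<close> with
    \<open>k \<ge> 1\<close>. This gives \<open>nbar \<ge> 1\<close>, so a user sends a positive
    number of segments on average and the division in \<open>p_fin\<close> is meaningful.\<close>
  have n_pos: "1 \<le> n h" if "h < \<theta>" for h
  proof (rule ccontr)
    assume "\<not> 1 \<le> n h"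
    then have "n h = 0" by simp
    then have "{..<n h} = {}" by simp
    moreover obtain I where "I \<subseteq> {..<n h}" "card I = col_rank (G h) k {..<n h}"
      using col_rank_witness[of "{..<n h}" "G h" k] by auto
    ultimately have "col_rank (G h) k {..<n h} = 0" by simp
    then show False using assms(4)[OF that] assms(1) by (simp add: good_code_def)
  qed
  have "(\<Sum>h<\<theta>. pmf \<Lambda> h * 1) \<le> nbar"
    unfolding nbar_def using n_pos by (intro sum_mono mult_left_mono) auto
  then have nbar: "1 \<le> nbar" by (simp add: sum_pmf_codes)
  have mean1: "mean_score (\<lambda>_ _. 1) = \<pi> * nbar" by (simp add: mean_score_def nbar_def)
  then have "0 < mean_score (\<lambda>_ _. 1)" using nbar assms(5) by simp
  note lim = p_fin_limit[OF this]
  show ?thesis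
  proof (intro conjI allI impI)
    have "- (\<alpha> / real k) * (\<pi> * nbar) = - \<pi> * \<alpha> / R" by (simp add: R_def)
    then show "(\<lambda>M. p_fin G k n \<Lambda> \<pi> \<alpha> M 0) \<longlonglongrightarrow> 1 - exp (- \<pi> * \<alpha> / R)"
      using lim[of 0] unfolding limit_clear.simps mean1 by simp
    fix l :: nat assume l: "1 \<le> l"
    \<comment> \<open>The witness is the limiting collision probability one level below;
      \<open>1 - q\<close> is then the probability that a neighbouring segment is known to the
      decoder.\<close>
    define q where "q = 1 - limit_clear (l - 1)"
    have "limit_clear l = exp (- (\<alpha> / real k) * mean_score (\<lambda>h. erasure_prob (G h) k (n h) (1 - q)))"
      using l by (cases l) (simp_all add: q_def)
    also have "- (\<alpha> / real k) * mean_score (\<lambda>h. erasure_prob (G h) k (n h) (1 - q))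
       = - (\<pi> * \<alpha> / real k) * (\<Sum>h<\<theta>. pmf \<Lambda> h *
                   (\<Sum>t<n h. q ^ t * (1 - q) ^ (n h - 1 - t) *
                      (real (n h - t) * real (info_fun (G h) k (n h) (n h - t))
                       - real (t + 1) * real (info_fun (G h) k (n h) (n h - 1 - t)))))"
      unfolding mean_score_def sum_erasure_prob by simp
    finally show "\<exists>q. (\<lambda>M. p_fin G k n \<Lambda> \<pi> \<alpha> M (l - 1)) \<longlonglongrightarrow> q
            \<and> (\<lambda>M. p_fin G k n \<Lambda> \<pi> \<alpha> M l) \<longlonglongrightarrow>
                1 - exp (- (\<pi> * \<alpha> / real k) * (\<Sum>h<\<theta>. pmf \<Lambda> h *
                   (\<Sum>t<n h. q ^ t * (1 - q) ^ (n h - 1 - t) *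
                      (real (n h - t) * real (info_fun (G h) k (n h) (n h - t))
                       - real (t + 1) * real (info_fun (G h) k (n h) (n h - 1 - t))))))"
      using lim[of "l - 1"] lim[of l] by (intro exI[of _ q]) (simp only: q_def[symmetric])
  qed
qed

end
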